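(* Let $G$ be a finite abelian group. Then $G\in\mathcal{G}_2$ if and only if $G\cong\mathbb{Z}_n$, where $n\in\{5,8,10,12\}$. Furthermore, a cycle of order $n$ is $2$-integral if and only if $n\in\{5,8,10,12\}$.
   Context: For a finite group $G$ and an inverse-closed subset $S\subseteq G\setminus\{1_G\}$, $\mathrm{Cay}(G,S)$ is the undirected graph with vertex set $G$ in which $g,h$ are adjacent if and only if $hg^{-1}\in S$; it has valency $|S|$ and is connected if and only if $G=\langle S\rangle$. A graph $\Gamma$ is $2$-integral if $[\mathbb{SF}(\Gamma):\mathbb{Q}]=2$, where $\mathbb{SF}(\Gamma)$ is the smallest extension of $\mathbb{Q}$ containing all eigenvalues of the adjacency matrix of $\Gamma$. $\mathcal{G}_k$ denotes the set of all finite groups admitting a connected $2$-integral undirected Cayley graph with valency $k$. *)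

theory Defs
  imports
    Complex_Main
    "HOL-Algebra.Elementary_Groups"
    "HOL-Algebra.Embedded_Algebras"
    "HOL-Algebra.Generated_Fields"
    "HOL-Algebra.Algebraic_Closure_Type"
    "Graph_Theory.Graph_Theory"
    "Jordan_Normal_Form.Char_Poly"
begin

text \<open>
  Finite simple undirected graphs are pair digraphs satisfying \<open>pair_graph\<close>:
  an edge between \<open>u\<close> and \<open>v\<close> is the pair of arcs \<open>(u, v)\<close> and \<open>(v, u)\<close>.
\<close>

text \<open>
  Matrices are indexed by \<open>{..<n}\<close>, so the adjacency matrix depends on an enumeration of the
  vertices. Different enumerations give similar matrices, hence the same eigenvalues.
\<close>

definition adjacency_matrix :: "'a pair_pre_digraph \<Rightarrow> 'a list \<Rightarrow> complex mat" where
  "adjacency_matrix \<Gamma> vs =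
     mat (length vs) (length vs) (\<lambda>(i, j). if (vs ! i, vs ! j) \<in> parcs \<Gamma> then 1 else 0)"

definition graph_eigenvalues :: "'a pair_pre_digraph \<Rightarrow> complex set" where
  "graph_eigenvalues \<Gamma> =
     {\<mu>. \<exists>vs. distinct vs \<and> set vs = pverts \<Gamma> \<and> eigenvalue (adjacency_matrix \<Gamma> vs) \<mu>}"

abbreviation complex_field :: "complex ring" where
  "complex_field \<equiv> ring_of_type_algebra"

definition splitting_field :: "'a pair_pre_digraph \<Rightarrow> complex set" where
  "splitting_field \<Gamma> = generate_field complex_field (\<rat> \<union> graph_eigenvalues \<Gamma>)"

text \<open>\<open>ring.dimension R n K E\<close> says that \<open>E\<close> has finite dimension \<open>n\<close> over \<open>K\<close>.\<close>

definition two_integral :: "'a pair_pre_digraph \<Rightarrow> bool" where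
  "two_integral \<Gamma> \<longleftrightarrow> ring.dimension complex_field 2 \<rat> (splitting_field \<Gamma>)"

definition has_valency :: "'a pair_pre_digraph \<Rightarrow> nat \<Rightarrow> bool" where
  "has_valency \<Gamma> k \<longleftrightarrow> (\<forall>v \<in> pverts \<Gamma>. out_degree (with_proj \<Gamma>) v = k)"

definition connection_set :: "('a, 'm) monoid_scheme \<Rightarrow> 'a set \<Rightarrow> bool" where
  "connection_set G S \<longleftrightarrow> S \<subseteq> carrier G - {\<one>\<^bsub>G\<^esub>} \<and> (\<forall>s \<in> S. inv\<^bsub>G\<^esub> s \<in> S)"

definition Cay :: "('a, 'm) monoid_scheme \<Rightarrow> 'a set \<Rightarrow> 'a pair_pre_digraph" where
  "Cay G S = \<lparr> pverts = carrier G,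
     parcs = {(g, h). g \<in> carrier G \<and> h \<in> carrier G \<and> h \<otimes>\<^bsub>G\<^esub> inv\<^bsub>G\<^esub> g \<in> S} \<rparr>"

lemma pair_graph_Cay:
  assumes "group G" "finite (carrier G)" "connection_set G S"
  shows "pair_graph (Cay G S)"
proof -
  interpret group G by fact
  have fin: "finite (parcs (Cay G S))"
    by (rule finite_subset[of _ "carrier G \<times> carrier G"]) (auto simp: Cay_def assms(2))
  have sym: "g \<otimes>\<^bsub>G\<^esub> inv\<^bsub>G\<^esub> h \<in> S"
    if "g \<in> carrier G" "h \<in> carrier G" "h \<otimes>\<^bsub>G\<^esub> inv\<^bsub>G\<^esub> g \<in> S" for g h
  proof -
    have "inv\<^bsub>G\<^esub> (h \<otimes>\<^bsub>G\<^esub> inv\<^bsub>G\<^esub> g) = g \<otimes>\<^bsub>G\<^esub> inv\<^bsub>G\<^esub> h"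
      using that by (simp add: inv_mult_group)
    with that assms(3) show ?thesis by (metis connection_set_def)
  qed
  show ?thesis
  proof
    show "finite (pverts (Cay G S))" using assms(2) by (simp add: Cay_def)
    show "finite (parcs (Cay G S))" by (fact fin)
    show "symmetric (with_proj (Cay G S))"
      using sym by (auto simp: symmetric_def sym_def Cay_def)
  qed (use assms(3) in \<open>auto simp: Cay_def connection_set_def\<close>)
qed

text \<open>
  The qualified name selects connectedness of digraphs rather than of topological spaces.
\<close>

definition groups_with_2_integral_Cay :: "nat \<Rightarrow> ('a, 'm) monoid_scheme set" (\<open>\<G>\<close>) where
  "\<G> k = {G. group G \<and> finite (carrier G) \<and>
     (\<exists>S. connection_set G S \<and>
          Digraph_Component.connected (with_proj (Cay G S)) \<and>
          has_valency (Cay G S) k \<and>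
          two_integral (Cay G S))}"

text \<open>
  A cycle of order \<open>n\<close> is a graph isomorphic to the \<open>n\<close>-cycle on \<open>{..<n}\<close>; simple graphs
  only have cycles of order at least 3.
\<close>

definition is_cycle_graph :: "'a pair_pre_digraph \<Rightarrow> nat \<Rightarrow> bool" where
  "is_cycle_graph \<Gamma> n \<longleftrightarrow> n \<ge> 3 \<and>
     (\<exists>v. bij_betw v {..<n} (pverts \<Gamma>) \<and>
          parcs \<Gamma> = {(v i, v j) | i j. i < n \<and> j < n \<and> (j = Suc i mod n \<or> i = Suc j mod n)})"

end

theory Submission
  imports Defs
begin

text \<open>
  The eigenvalues of an \<open>n\<close>-cycle are the numbers \<open>z + 1/z\<close> with \<open>z ^ n = 1\<close>, all of which are integer
  polynomials in \<open>\<alpha> = 2 cos (2 \<pi> / n)\<close>; hence the splitting field is \<open>\<rat>(\<alpha>)\<close>.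
  If \<open>\<alpha>\<close> is quadratic, then by Gauss's lemma it satisfies \<open>\<alpha>\<^sup>2 = A \<alpha> + B\<close> with integers \<open>A, B\<close>, and the
  conjugate \<open>A - \<alpha>\<close> is again an eigenvalue of the cycle. So \<open>\<alpha>\<close> and its conjugate both lie in \<open>[-2, 2]\<close>,
  which leaves finitely many \<open>(A, B)\<close> and, as \<open>\<alpha>\<close> determines \<open>n\<close>, only \<open>n = 5, 8, 10, 12\<close>.

  A connected Cayley graph of valency 2 on an abelian group is a cycle: either the connection set is \<open>{s, s\<^sup>-\<^sup>1}\<close>
  and \<open>s\<close> generates the group, or it consists of two involutions and the graph is the 4-cycle, which is integral.
\<close>

section \<open>The numbers \<open>2 cos (2 \<pi> / n)\<close> of degree 2\<close>

text \<open>Gauss's lemma in the form needed here. Clearing denominators gives a primitive integer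
  quadratic \<open>Q\<close> with root \<alpha>. It divides \<open>p\<close> up to a constant,
  comparing contents removes the constant, and monicity of \<open>p\<close> then forces the leading
  coefficient of \<open>Q\<close> to be a unit.\<close>

lemma quadratic_factor_of_monic_int_poly:
  fixes \<alpha> :: complex and p :: "int poly"
  assumes monic: "lead_coeff p = 1" and root: "poly (of_int_poly p) \<alpha> = 0"
    and irr: "\<alpha> \<notin> \<rat>" and quad: "\<alpha>\<^sup>2 = a * \<alpha> + b" "a \<in> \<rat>" "b \<in> \<rat>"
  shows "\<exists>A B :: int. \<alpha>\<^sup>2 = of_int A * \<alpha> + of_int B \<and> [:- B, - A, 1:] dvd p"
proof -
  obtain a1 a2 where a: "a = of_int a1 / of_int a2" "a2 > 0"
    using quad(2) by (auto elim: Rats_cases')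
  obtain b1 b2 where b: "b = of_int b1 / of_int b2" "b2 > 0"
    using quad(3) by (auto elim: Rats_cases')
  \<comment> \<open>This is X^2 - a X - b multiplied by the common denominator
    \<open>a2 * b2\<close>.\<close>
  define Q0 where "Q0 = [:- b1 * a2, - a1 * b2, a2 * b2:]"
  define Q where "Q = primitive_part Q0"
  have Q0: "Q0 \<noteq> 0" "degree Q0 = 2" using a b by (auto simp: Q0_def)
  have root_Q0: "poly (of_int_poly Q0) \<alpha> = 0"
  proof -
    have "of_int a1 = a * of_int a2" "of_int b1 = b * of_int b2" using a b by auto
    then have "poly (of_int_poly Q0) \<alpha> = of_int a2 * of_int b2 * (\<alpha>\<^sup>2 - (a * \<alpha> + b))"
      by (simp add: Q0_def of_int_hom.map_poly_pCons_hom) (simp add: algebra_simps power2_eq_square)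
    then show ?thesis using quad(1) by simp
  qed
  have content_Q: "content Q = 1" and Q_nz: "Q \<noteq> 0" and deg_Q: "degree Q = 2"
    using Q0 by (auto simp: Q_def)
  have "of_int_poly Q0 = Polynomial.smult (of_int (content Q0) :: complex) (of_int_poly Q)"
    unfolding Q_def of_int_hom.map_poly_hom_smult[symmetric] by simp
  then have root_Q: "poly (of_int_poly Q) \<alpha> = 0"
    using root_Q0 Q0 by simp
  \<comment> \<open>\<open>Q\<close> is not yet known to be monic, so division over the integers
    costs a power of its leading coefficient \<open>c\<close>.\<close>
  obtain s r where sr: "pseudo_divmod p Q = (s, r)" by fastforce
  define c where "c = coeff Q 2"
  define k where "k = Suc (degree p) - degree Q"
  have div: "smult (c ^ k) p = Q * s + r" "r = 0 \<or> degree r < 2"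
    using pseudo_divmod[OF Q_nz sr] by (auto simp: c_def k_def deg_Q)
  have root_r: "poly (of_int_poly r) \<alpha> = 0"
  proof -
    have "r = smult (c ^ k) p - Q * s" using div by simp
    then show ?thesis using root root_Q
      by (simp add: of_int_poly_hom.hom_minus of_int_poly_hom.hom_mult of_int_hom.map_poly_hom_smult)
  qed
  \<comment> \<open>The remainder has degree below 2 and vanishes at \<alpha>; a nonzero one would
    be linear and make \<alpha> rational.\<close>
  have "r = 0"
  proof (rule ccontr)
    assume "r \<noteq> 0"
    obtain u v where r: "r = [:u, v:]"
    proof
      show "r = [:coeff r 0, coeff r 1:]"
        using div(2) \<open>r \<noteq> 0\<close> by (intro poly_eqI) (auto simp: coeff_pCons coeff_eq_0 split: nat.splits)
    qed
    then have "of_int u + \<alpha> * of_int v = 0"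
      using root_r by (simp add: of_int_hom.map_poly_pCons_hom)
    moreover have "v \<noteq> 0" using calculation \<open>r \<noteq> 0\<close> r by auto
    ultimately have "\<alpha> = - of_int u / of_int v" by (simp add: field_simps add_eq_0_iff)
    with irr show False by (auto intro: Rats_divide)
  qed
  have c: "c \<noteq> 0" using deg_Q Q_nz c_def by (metis leading_coeff_neq_0)
  \<comment> \<open>Both \<open>p\<close> and \<open>Q\<close> have content 1, so the whole factor
    \<open>c ^ k\<close> sits in \<open>s\<close> and can be cancelled.\<close>
  have "content p = 1"
    using monic content_dvd_coeff[of p "degree p"] by (metis is_unit_content_iff)
  then have "content s = normalize (c ^ k)"
    using div(1) \<open>r = 0\<close> content_Q content_mult[of Q s] content_smult[of "c ^ k" p] by simp
  then have "[:c ^ k:] dvd s" by (simp add: const_poly_dvd_iff_dvd_content)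
  then obtain t where "s = smult (c ^ k) t" by (auto elim: dvdE)
  then have "smult (c ^ k) (p - Q * t) = 0"
    using div(1) \<open>r = 0\<close> by (simp add: smult_diff_right)
  then have t: "p = Q * t"
    using c by simp
  then have "c * lead_coeff t = 1"
    using monic by (simp add: lead_coeff_mult c_def deg_Q)
  then have c1: "c = 1 \<or> c = - 1" by (auto simp: zmult_eq_1_iff)
  \<comment> \<open>Since \<open>c\<close> is 1 or -1, multiplying \<open>Q\<close> by
    \<open>c\<close> makes it monic; its lower coefficients are then \<open>- A\<close> and
    \<open>- B\<close>.\<close>
  define A B where "A = - c * coeff Q 1" and "B = - c * coeff Q 0"
  have Q: "Q = smult c [:- B, - A, 1:]"
    using c1 deg_Q by (intro poly_eqI)
      (auto simp: coeff_pCons A_def B_def c_def coeff_eq_0 numeral_2_eq_2 split: nat.splits)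
  then have "[:- B, - A, 1:] dvd Q" by (metis dvd_smult dvd_refl)
  then have "[:- B, - A, 1:] dvd p" unfolding t by (rule dvd_mult2)
  moreover have "\<alpha>\<^sup>2 = of_int A * \<alpha> + of_int B"
    using root_Q c1 by (subst (asm) Q) (auto simp: algebra_simps power2_eq_square)
  ultimately show ?thesis by blast
qed

text \<open>These are the rescaled Chebyshev polynomials 2 T_n(x/2). The scaling keeps the
  coefficients integral and makes every member after the constant 2 monic.\<close>

fun cheb :: "nat \<Rightarrow> int poly" where
  "cheb 0 = [:2:]"
| "cheb (Suc 0) = [:0, 1:]"
| "cheb (Suc (Suc n)) = [:0, 1:] * cheb (Suc n) - cheb n"

text \<open>In the recurrence the subtracted polynomial has degree two less than the new one, so it
  cannot affect the leading term. The index starts at \<open>Suc n\<close> because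
  \<open>cheb 0\<close> is the constant 2.\<close>

lemma cheb_monic:
  "degree (cheb (Suc n)) = Suc n \<and> lead_coeff (cheb (Suc n)) = 1"
proof (induction n rule: less_induct)
  case (less n)
  show ?case
  proof (cases n)
    case (Suc m)
    have IH: "degree (cheb (Suc m)) = Suc m" "lead_coeff (cheb (Suc m)) = 1"
      using less[of m] Suc by auto
    have "degree (cheb m) \<le> m" using less[of "m - 1"] Suc by (cases m) auto
    moreover have "degree ([:0, 1:] * cheb (Suc m)) = Suc (Suc m)"
      using IH by (subst degree_mult_eq) auto
    moreover have "coeff ([:0, 1:] * cheb (Suc m)) (Suc (Suc m)) = 1"
      using IH by (simp del: cheb.simps)
    ultimately show ?thesis unfolding Suc
      using degree_add_eq_left[of "- cheb m" "[:0, 1:] * cheb (Suc m)"]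
      by (simp only: cheb.simps) (simp add: coeff_eq_0)
  qed auto
qed

text \<open>The recurrence of \<open>cheb\<close> mirrors the identity (z + 1/z)(z^(n+1) + z^-(n+1))
  = (z^(n+2) + z^-(n+2)) + (z^n + z^-n).\<close>

lemma poly_cheb:
  fixes z :: complex
  assumes "z \<noteq> 0"
  shows "poly (of_int_poly (cheb n)) (z + inverse z) = z ^ n + inverse z ^ n"
proof (induction n rule: cheb.induct)
  case (3 n)
  have "poly (of_int_poly (cheb (Suc (Suc n)))) (z + inverse z) =
      (z + inverse z) * poly (of_int_poly (cheb (Suc n))) (z + inverse z)
      - poly (of_int_poly (cheb n)) (z + inverse z)"
    unfolding cheb.simps of_int_poly_hom.hom_minus of_int_poly_hom.hom_mult of_int_hom.map_poly_pCons_hom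
    by simp
  moreover have "inverse z * z ^ Suc n = z ^ n" "z * inverse z ^ Suc n = inverse z ^ n"
    using assms by simp_all
  ultimately show ?case unfolding 3 by (simp only: distrib_left distrib_right power_Suc) simp
qed auto

text \<open>Take a root of z^2 - x z + 1, given by the quadratic formula; its constant term 1 keeps
  the root away from 0.\<close>

lemma obtain_joukowski:
  fixes x :: complex
  obtains z where "z \<noteq> 0" "x = z + inverse z"
proof -
  define z where "z = (x + csqrt (x\<^sup>2 - 4)) / 2"
  have "(2 * z - x)\<^sup>2 = x\<^sup>2 - 4" unfolding z_def by (simp add: field_simps)
  then have *: "z\<^sup>2 + 1 = x * z"
    by (rule_tac mult_left_cancel[of 4, THEN iffD1]) (simp_all add: power2_eq_square algebra_simps)
  then have "z \<noteq> 0" by auto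
  with * have "x = z + inverse z" by (simp add: field_simps power2_eq_square)
  with \<open>z \<noteq> 0\<close> that show ?thesis by blast
qed

text \<open>Substituting x = z + 1/z turns the equation into (z^n - 1)^2 = 0, so z lies on the unit
  circle and x is a sum of two numbers of modulus 1. The bound holds for every root, hence also for
  the conjugate of \<open>two_cos n\<close>.\<close>

lemma root_cheb_minus_2:
  assumes "poly (of_int_poly (cheb n - [:2:])) x = 0" "n > 0"
  shows "cmod x \<le> 2"
proof -
  obtain z where z: "z \<noteq> 0" "x = z + inverse z" by (rule obtain_joukowski)
  then have "z ^ n + inverse z ^ n = 2" using assms(1) by (simp add: of_int_poly_hom.hom_minus of_int_hom.map_poly_pCons_hom poly_cheb)
  then have "z ^ n * (z ^ n + inverse (z ^ n)) = z ^ n * 2" by (simp add: power_inverse)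
  then have "(z ^ n - 1)\<^sup>2 = 0"
    using z(1) by (simp add: distrib_left power2_diff) (simp add: power2_eq_square)
  then have "z ^ n = 1" by simp
  then have "cmod z = 1" using assms(2) by (metis norm_one norm_power norm_ge_zero power_eq_1_iff neq0_conv)
  moreover have "cmod x \<le> cmod z + cmod (inverse z)" using z norm_triangle_ineq by blast
  ultimately show ?thesis by (simp add: norm_inverse)
qed

section \<open>Values of 2 cos (2 pi / n)\<close>

definition two_cos :: "nat \<Rightarrow> real" where
  "two_cos n = 2 * cos (2 * pi / n)"

lemma of_real_two_cos: "complex_of_real (two_cos n) = cis (2 * pi / n) + inverse (cis (2 * pi / n))"
  by (simp add: two_cos_def complex_eq_iff)

lemma two_cos_squared:
  "(two_cos 5)\<^sup>2 = 1 - two_cos 5" "(two_cos 8)\<^sup>2 = 2"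
  "(two_cos 10)\<^sup>2 = two_cos 10 + 1" "(two_cos 12)\<^sup>2 = 3"
proof -
  define c where "c = cos (2 * pi / 5)"
  \<comment> \<open>For t = 2 pi / 5 the angles 3t and 2t add up to a full turn. The resulting cubic
    in cos t has the spurious root 1, which is split off.\<close>
  have "cos (3 * (2 * pi / 5)) = cos (2 * (2 * pi / 5))"
    using cos_2pi_minus[of "2 * (2 * pi / 5)"] by (simp add: algebra_simps)
  then have "4 * c ^ 3 - 3 * c = 2 * c\<^sup>2 - 1"
    unfolding c_def cos_treble_cos cos_double_cos .
  then have "(c - 1) * (4 * c\<^sup>2 + 2 * c - 1) = 0"
    by (simp add: algebra_simps power2_eq_square power3_eq_cube)
  moreover have "c \<noteq> 1"
    using cos_monotone_0_pi[of 0 "2 * pi / 5"] pi_gt_zero by (simp add: c_def)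
  ultimately have c: "4 * c\<^sup>2 = 1 - 2 * c" by simp
  then show "(two_cos 5)\<^sup>2 = 1 - two_cos 5"
    by (simp add: two_cos_def c_def power2_eq_square)
  \<comment> \<open>The angle pi / 5 is the supplement of 4 pi / 5, which reduces the case 10 to the
    case 5.\<close>
  have "cos (2 * pi / 10) = - cos (2 * (2 * pi / 5))"
    using cos_minus_pi[of "2 * (2 * pi / 5)"] cos_minus[of "pi / 5"] by (simp add: field_simps)
  then have "two_cos 10 = 1 + 2 * c"
    using c unfolding cos_double_cos by (simp add: two_cos_def c_def)
  then show "(two_cos 10)\<^sup>2 = two_cos 10 + 1"
    using c by (simp add: power2_eq_square algebra_simps)
  show "(two_cos 8)\<^sup>2 = 2" "(two_cos 12)\<^sup>2 = 3"
    by (simp_all add: two_cos_def cos_45 cos_30 power_mult_distrib power_divide)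
qed

text \<open>The angle lies strictly between 0 and pi / 2. Positivity later tells
  \<open>two_cos n\<close> apart from its conjugate, which is negative in the surviving
  cases.\<close>

lemma two_cos_pos:
  assumes "n > 4"
  shows "two_cos n > 0"
proof -
  have "0 < 2 * pi / n" using assms by simp
  moreover have "2 * pi / n < 2 * pi / 4"
    using assms by (intro divide_strict_left_mono) auto
  ultimately show ?thesis
    using cos_gt_zero_pi[of "2 * pi / n"] by (simp add: two_cos_def)
qed

lemma two_cos_inject:
  assumes "m > 4" "n > 4" "two_cos m = two_cos n"
  shows "m = n"
proof -
  have range: "0 \<le> 2 * pi / k \<and> 2 * pi / k \<le> pi" if "k > 4" for k :: nat
  proof -
    have "2 * pi / k \<le> 2 * pi / 2" using that by (intro divide_left_mono) auto
    then show ?thesis by simp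
  qed
  have "2 * pi / m = 2 * pi / n"
    by (rule cos_inj_pi) (use assms range in \<open>simp_all add: two_cos_def\<close>)
  then show ?thesis using assms by simp
qed

lemma two_cos_quadratic_imp:
  fixes n :: nat
  assumes n: "n \<ge> 3" and irr: "complex_of_real (two_cos n) \<notin> \<rat>"
    and quad: "(complex_of_real (two_cos n))\<^sup>2 = a * complex_of_real (two_cos n) + b" "a \<in> \<rat>" "b \<in> \<rat>"
  shows "n \<in> {5, 8, 10, 12}"
proof -
  define x where "x = two_cos n"
  define p where "p = cheb n - [:2:]"
  obtain m where m: "n = Suc m" using n by (cases n) auto
  have p: "p = cheb n + [:- 2:]" by (simp add: p_def)
  have "degree p = n"
    using cheb_monic[of m] degree_add_eq_left[of "[:- 2:]" "cheb n"] m by (simp add: p)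
  moreover have "coeff (cheb n) n = 1" using cheb_monic[of m] m by metis
  ultimately have lc: "lead_coeff p = 1" using m by (simp add: p coeff_pCons)
  have "cis (2 * pi / n) ^ n = 1"
    using n by (simp add: DeMoivre)
  then have root: "poly (of_int_poly p) (complex_of_real x) = 0"
    unfolding p_def of_int_poly_hom.hom_minus x_def of_real_two_cos
    by (simp add: poly_cheb power_inverse del: cis_inverse)
  obtain A B where AB: "(complex_of_real x)\<^sup>2 = of_int A * of_real x + of_int B" and dvd: "[:- B, - A, 1:] dvd p"
    using quadratic_factor_of_monic_int_poly[OF lc root irr[folded x_def] quad[folded x_def]] by blast
  have "complex_of_real (x\<^sup>2) = complex_of_real (of_int A * x + of_int B)" using AB by simp
  then have x2: "x\<^sup>2 = of_int A * x + of_int B" by (simp only: of_real_eq_iff)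
  \<comment> \<open>The other root of X^2 - A X - B. As this quadratic divides \<open>p\<close>, the
    bound on the roots of \<open>p\<close> applies to it too.\<close>
  define y where "y = of_int A - x"
  have y2: "y\<^sup>2 = of_int A * y + of_int B" using x2 by (simp add: y_def power2_eq_square algebra_simps)
  then have "complex_of_real (y\<^sup>2) = complex_of_real (of_int A * y + of_int B)" by simp
  then have "poly (of_int_poly [:- B, - A, 1:]) (complex_of_real y) = 0"
    by (simp add: of_int_hom.map_poly_pCons_hom power2_eq_square algebra_simps)
  with dvd have "poly (of_int_poly p) (complex_of_real y) = 0"
    by (auto elim!: dvdE simp: of_int_poly_hom.hom_mult simp del: mult_pCons_left)
  then have ybd: "\<bar>y\<bar> \<le> 2" using root_cheb_minus_2[of n "complex_of_real y"] n by (simp add: p_def)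
  have xbd: "\<bar>x\<bar> \<le> 2" unfolding x_def two_cos_def by (simp add: abs_mult)
  \<comment> \<open>Excluding half-integers, and not only integers, is what rules out x = y, where x
    would equal A / 2.\<close>
  have x_irr: "x \<noteq> of_int i / 2" for i :: int
  proof
    assume "x = of_int i / 2"
    then have "x \<in> \<rat>" by (simp only: Rats_divide Rats_of_int Rats_number_of)
    then show False using irr[folded x_def] by simp
  qed
  have x_int: "x \<noteq> of_int i" for i :: int using x_irr[of "2 * i"] by simp
  have xy: "x + y = of_int A" "x * y = - of_int B"
    using x2 by (auto simp: y_def power2_eq_square algebra_simps)
  have "x \<noteq> 2" "x \<noteq> - 2" using x_int[of 2] x_int[of "- 2"] by simp_all
  moreover have "y \<noteq> 2" "y \<noteq> - 2"
    using x_int[of "A - 2"] x_int[of "A + 2"] by (auto simp: y_def)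
  ultimately have "x < 2" "- 2 < x" "y < 2" "- 2 < y" using xbd ybd by auto
  moreover have "x \<noteq> y" using x_irr[of A] xy(1) by auto
  ultimately have "(2 - x) * (2 - y) > 0" "(2 + x) * (2 + y) > 0" "(x - y)\<^sup>2 > 0"
    by simp_all
  \<comment> \<open>These products are symmetric in x and y, so they are integers, expressed by
    \<open>A\<close> and \<open>B\<close> through Vieta's formulas; the last one is the
    discriminant.\<close>
  moreover have "(2 - x) * (2 - y) = of_int (4 - 2 * A - B)" "(2 + x) * (2 + y) = of_int (4 + 2 * A - B)"
      "(x - y)\<^sup>2 = of_int (A * A + 4 * B)"
  proof -
    have "(2 - x) * (2 - y) = 4 - 2 * (x + y) + x * y" by (simp add: algebra_simps)
    then show "(2 - x) * (2 - y) = of_int (4 - 2 * A - B)" unfolding xy by simp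
    have "(2 + x) * (2 + y) = 4 + 2 * (x + y) + x * y" by (simp add: algebra_simps)
    then show "(2 + x) * (2 + y) = of_int (4 + 2 * A - B)" unfolding xy by simp
    have "(x - y)\<^sup>2 = (x + y) * (x + y) - 4 * (x * y)" by (simp add: algebra_simps power2_eq_square)
    then show "(x - y)\<^sup>2 = of_int (A * A + 4 * B)" unfolding xy by simp
  qed
  ultimately have ineqs: "4 - 2 * A - B > 0" "4 + 2 * A - B > 0" "A * A + 4 * B > 0"
    by (simp_all only: of_int_0_less_iff)
  have "\<bar>of_int A :: real\<bar> \<le> of_int 4" using xbd ybd xy(1) by simp
  then have "\<bar>A\<bar> \<le> 4" by linarith
  then have "A \<in> {-4, -3, -2, -1, 0, 1, 2, 3, 4}" by auto
  \<comment> \<open>The inequalities say -A^2/4 < B < 4 - 2|A|, and no integer B satisfies this when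
    |A| is 2, 3 or 4.\<close>
  with ineqs have "A = 0 \<and> B \<in> {1, 2, 3} \<or> (A = 1 \<or> A = -1) \<and> (B = 0 \<or> B = 1)" by auto
  moreover have "\<not> (A = 0 \<and> B = 1)"
    using x2 x_int[of 1] x_int[of "-1"] by (auto simp: power2_eq_1_iff)
  moreover have "B \<noteq> 0"
  proof
    assume "B = 0"
    then have "x * (x - of_int A) = 0" using x2 by (simp add: power2_eq_square algebra_simps)
    then show False using x_int[of 0] x_int[of A] by auto
  qed
  \<comment> \<open>What remains is x^2 = 2, x^2 = 3, x^2 = x + 1 and x^2 = 1 - x, the equations of
    \<open>two_cos\<close> at 8, 12, 10 and 5.\<close>
  ultimately have cases: "A = 0 \<and> B = 2 \<or> A = 0 \<and> B = 3 \<or> A = 1 \<and> B = 1 \<or> A = -1 \<and> B = 1" by auto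
  have n4: "n > 4"
  proof -
    have "n \<noteq> 3" using x_int[of "-1"] cos_120 by (auto simp: x_def two_cos_def)
    moreover have "n \<noteq> 4" using x_int[of 0] by (auto simp: x_def two_cos_def)
    ultimately show ?thesis using n by auto
  qed
  \<comment> \<open>If \<open>two_cos k\<close> solves the same quadratic, it is x or y. It cannot
    be y, because xy = -B is negative while both cosines are positive.\<close>
  have eqI: "n = k" if k: "k > 4" "(two_cos k)\<^sup>2 = of_int A * two_cos k + of_int B" for k
  proof -
    have pos: "x > 0" "two_cos k > 0" using two_cos_pos n4 k by (auto simp: x_def)
    have "(x - two_cos k) * (x + two_cos k - of_int A) = 0"
      using x2 k(2) by (simp add: algebra_simps power2_eq_square)
    moreover have "x + two_cos k \<noteq> of_int A"
    proof
      assume "x + two_cos k = of_int A"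
      then have "two_cos k = y" by (simp add: y_def)
      then have "x * two_cos k = - of_int B" using xy(2) by simp
      moreover have "x * two_cos k > 0" using pos by simp
      ultimately show False using cases by auto
    qed
    ultimately show ?thesis using two_cos_inject[OF n4 k(1)] by (simp add: x_def)
  qed
  show ?thesis
    using cases eqI[of 5] eqI[of 8] eqI[of 10] eqI[of 12] two_cos_squared by auto
qed

text \<open>Irrationality: each number is an algebraic integer, so if rational it would be an
  integer strictly between 0 and 2, that is 1. The clause \<open>1 \<noteq> A + B\<close> says that
  1 does not solve the quadratic.\<close>

lemma two_cos_quadratic:
  assumes "n \<in> {5, 8, 10, 12}"
  shows "complex_of_real (two_cos n) \<notin> \<rat>"
    and "\<exists>a \<in> \<rat>. \<exists>b \<in> \<rat>. (complex_of_real (two_cos n))\<^sup>2 = a * complex_of_real (two_cos n) + b"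
proof -
  have "\<exists>A B :: int. (two_cos n)\<^sup>2 = of_int A * two_cos n + of_int B \<and> 1 \<noteq> A + B"
    using assms
  proof (elim insertE emptyE)
    assume "n = 5" then show ?thesis using two_cos_squared by (intro exI[of _ "-1"] exI[of _ 1]) auto
  next
    assume "n = 8" then show ?thesis using two_cos_squared by (intro exI[of _ 0] exI[of _ 2]) auto
  next
    assume "n = 10" then show ?thesis using two_cos_squared by (intro exI[of _ 1] exI[of _ 1]) auto
  next
    assume "n = 12" then show ?thesis using two_cos_squared by (intro exI[of _ 0] exI[of _ 3]) auto
  qed
  then obtain A B :: int where AB: "(two_cos n)\<^sup>2 = of_int A * two_cos n + of_int B" "1 \<noteq> A + B" by blast
  then have "complex_of_real ((two_cos n)\<^sup>2) = complex_of_real (of_int A * two_cos n + of_int B)" by simp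
  then have AB': "(complex_of_real (two_cos n))\<^sup>2 = of_int A * of_real (two_cos n) + of_int B" by simp
  then show "\<exists>a \<in> \<rat>. \<exists>b \<in> \<rat>. (complex_of_real (two_cos n))\<^sup>2 = a * complex_of_real (two_cos n) + b"
    using Rats_of_int by blast
  show "complex_of_real (two_cos n) \<notin> \<rat>"
  proof
    assume rat: "complex_of_real (two_cos n) \<in> \<rat>"
    have "algebraic_int (complex_of_real (two_cos n))"
      unfolding algebraic_int_altdef_ipoly
      by (intro exI[of _ "[:- B, - A, 1:]"])
        (use AB' in \<open>simp add: of_int_hom.map_poly_pCons_hom algebra_simps power2_eq_square\<close>)
    then have "complex_of_real (two_cos n) \<in> \<int>" using rat by (rule rational_algebraic_int_is_int)
    then obtain i :: int where "complex_of_real (two_cos n) = of_int i" by (auto elim: Ints_cases)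
    then have i: "two_cos n = of_int i" by (metis of_real_eq_iff of_real_of_int_eq)
    have "n > 4" using assms by auto
    then have "two_cos n > 0" by (rule two_cos_pos)
    moreover have "two_cos n < 2"
      using cos_monotone_0_pi[of 0 "2 * pi / n"] \<open>n > 4\<close> by (simp add: two_cos_def field_simps)
    ultimately have "i = 1" using i by simp
    then show False using AB i by simp
  qed
qed

section \<open>Quadratic extensions of the rationals\<close>

lemma field_complex: "field complex_field" by (rule field_from_type_algebra)

lemma complex_field_simps [simp]:
  "carrier complex_field = UNIV" "x \<otimes>\<^bsub>complex_field\<^esub> y = x * y" "x \<oplus>\<^bsub>complex_field\<^esub> y = x + y"
  "\<one>\<^bsub>complex_field\<^esub> = 1" "\<zero>\<^bsub>complex_field\<^esub> = 0"
  by (simp_all add: ring_of_type_algebra_def)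

interpretation CF: cring complex_field by (rule cring_from_type_algebra)

lemmas complex_generate_field_min = field.generate_field_min_subfield1[OF field_complex]
lemmas complex_generate_subfield = field.generate_field_is_subfield[OF field_complex]

lemma a_inv_complex_field [simp]: "\<ominus>\<^bsub>complex_field\<^esub> x = - x"
  by (rule CF.minus_equality) auto

lemma m_inv_complex_field [simp]: "x \<noteq> 0 \<Longrightarrow> inv\<^bsub>complex_field\<^esub> x = inverse x"
  by (rule CF.comm_inv_char) auto

lemma subfield_complexI:
  assumes "1 \<in> K" "\<And>x. x \<in> K \<Longrightarrow> - x \<in> K" "\<And>x. x \<in> K \<Longrightarrow> x \<noteq> 0 \<Longrightarrow> inverse x \<in> K"
    "\<And>x y. x \<in> K \<Longrightarrow> y \<in> K \<Longrightarrow> x * y \<in> K" "\<And>x y. x \<in> K \<Longrightarrow> y \<in> K \<Longrightarrow> x + y \<in> K"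
  shows "subfield K complex_field"
  using assms by (intro field.subfieldI'[OF field_complex] CF.subringI) auto

lemma subfield_Rats: "subfield \<rat> complex_field"
  by (rule subfield_complexI) auto

lemma line_extension_complex: "CF.line_extension K x E = {a * x + e | a e. a \<in> K \<and> e \<in> E}"
  by (auto simp: CF.line_extension_def set_add_def set_mult_def r_coset_def)

lemma Span_pair:
  "CF.Span \<rat> [\<alpha>, 1] = {a * \<alpha> + b | a b. a \<in> \<rat> \<and> b \<in> \<rat>}"
  by (auto simp: line_extension_complex)

lemma independent_pair: "CF.independent \<rat> [\<alpha>, 1] \<longleftrightarrow> \<alpha> \<notin> \<rat>"
proof
  assume "CF.independent \<rat> [\<alpha>, 1]"
  then have "\<alpha> \<notin> CF.Span \<rat> [1]" by (rule CF.independent_backwards)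
  then show "\<alpha> \<notin> \<rat>" by (auto simp: line_extension_complex)
qed (auto simp: line_extension_complex intro!: CF.li_Cons)

text \<open>Products are reduced with the quadratic equation. Inverses come from the norm: an
  element times its conjugate is rational.\<close>

lemma quadratic_extension_subfield:
  assumes irr: "\<alpha> \<notin> \<rat>" and quad: "\<alpha>\<^sup>2 = p * \<alpha> + q" "p \<in> \<rat>" "q \<in> \<rat>"
  shows "subfield {a * \<alpha> + b | a b. a \<in> \<rat> \<and> b \<in> \<rat>} complex_field" (is "subfield ?K _")
proof -
  have memI: "a * \<alpha> + b \<in> ?K" if "a \<in> \<rat>" "b \<in> \<rat>" for a b
    using that by blast
  show ?thesis
  proof (rule subfield_complexI)
    show "1 \<in> ?K" using memI[of 0 1] by simp
    fix x assume "x \<in> ?K"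
    then obtain a b where x: "x = a * \<alpha> + b" "a \<in> \<rat>" "b \<in> \<rat>" by blast
    show "- x \<in> ?K" using memI[of "- a" "- b"] x by simp
    show "inverse x \<in> ?K" if "x \<noteq> 0"
    proof -
      \<comment> \<open>the conjugate of \<open>\<alpha>\<close> is \<open>p - \<alpha>\<close>\<close>
      define N where "N = a * b * p + b\<^sup>2 - a\<^sup>2 * q"
      have N: "N = x * (a * (p - \<alpha>) + b)" "N \<in> \<rat>"
      proof -
        have "x * (a * (p - \<alpha>) + b) = a\<^sup>2 * (p * \<alpha> - \<alpha>\<^sup>2) + a * b * p + b\<^sup>2"
          by (simp add: x algebra_simps power2_eq_square)
        also have "\<dots> = N" by (simp add: quad(1) N_def)
        finally show "N = x * (a * (p - \<alpha>) + b)" by simp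
      qed (use x quad in \<open>auto simp: N_def\<close>)
      \<comment> \<open>If this conjugate vanished, a nonzero \<open>a\<close> would make \<alpha>
        rational, while a = 0 would give b = 0 and hence x = 0.\<close>
      have "a * (p - \<alpha>) + b \<noteq> 0"
      proof
        assume *: "a * (p - \<alpha>) + b = 0"
        have "a = 0"
        proof (rule ccontr)
          assume "a \<noteq> 0"
          then have "\<alpha> = p + b / a" using * by (simp add: field_simps)
          then show False using irr x quad by auto
        qed
        then show False using * x \<open>x \<noteq> 0\<close> by simp
      qed
      then have "N \<noteq> 0" using N(1) \<open>x \<noteq> 0\<close> by simp
      then have "inverse x = (a * (p - \<alpha>) + b) / N"
        using N(1) by (intro inverse_unique) simp
      also have "\<dots> = (- a / N) * \<alpha> + (a * p + b) / N"
        by (simp add: add_divide_distrib diff_divide_distrib algebra_simps)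
      finally have "inverse x = (- a / N) * \<alpha> + (a * p + b) / N" .
      then show ?thesis using memI[of "- a / N" "(a * p + b) / N"] x quad N(2) by simp
    qed
    fix y assume "y \<in> ?K"
    then obtain c d where y: "y = c * \<alpha> + d" "c \<in> \<rat>" "d \<in> \<rat>" by blast
    have "x * y = a * c * \<alpha>\<^sup>2 + (a * d + b * c) * \<alpha> + b * d"
      by (simp add: x y algebra_simps power2_eq_square)
    also have "\<dots> = (a * c * p + a * d + b * c) * \<alpha> + (a * c * q + b * d)"
      by (simp add: quad(1) algebra_simps)
    finally show "x * y \<in> ?K" using memI x y quad by (simp add: Rats_add Rats_mult)
    show "x + y \<in> ?K" using memI[of "a + c" "b + d"] x y by (simp add: algebra_simps)
  qed
qed

text \<open>Lets a whole spectrum be replaced by one eigenvalue that generates all the others; both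
  inclusions follow from minimality of the generated field.\<close>

lemma generate_field_absorb:
  assumes "E \<subseteq> generate_field complex_field (\<rat> \<union> {\<alpha>})" "\<alpha> \<in> E"
  shows "generate_field complex_field (\<rat> \<union> E) = generate_field complex_field (\<rat> \<union> {\<alpha>})"
proof
  show "generate_field complex_field (\<rat> \<union> E) \<subseteq> generate_field complex_field (\<rat> \<union> {\<alpha>})"
    using assms(1)
    by (intro complex_generate_field_min complex_generate_subfield) (auto intro: generate_field.incl)
  show "generate_field complex_field (\<rat> \<union> {\<alpha>}) \<subseteq> generate_field complex_field (\<rat> \<union> E)"
    using assms(2)
    by (intro complex_generate_field_min complex_generate_subfield) (auto intro: generate_field.incl)
qed

text \<open>In dimension 2 the elements \<alpha>^2, \<alpha>, 1 are dependent, while \<alpha>, 1 are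
  independent for irrational \<alpha>. Conversely, the span of \<alpha> and 1 is already a field, so
  it is the generated one.\<close>

lemma dimension_2_simple_extension:
  "CF.dimension 2 \<rat> (generate_field complex_field (\<rat> \<union> {\<alpha>})) \<longleftrightarrow>
     \<alpha> \<notin> \<rat> \<and> (\<exists>a \<in> \<rat>. \<exists>b \<in> \<rat>. \<alpha>\<^sup>2 = a * \<alpha> + b)"
    (is "CF.dimension 2 \<rat> ?F \<longleftrightarrow> _")
proof
  assume dim: "CF.dimension 2 \<rat> ?F"
  have irr: "\<alpha> \<notin> \<rat>"
  proof
    assume "\<alpha> \<in> \<rat>"
    then have "?F = \<rat>"
      using complex_generate_field_min[OF _ subfield_Rats, of "\<rat> \<union> {\<alpha>}"]
      by (auto intro: generate_field.incl)
    then show False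
      using CF.dimension_is_inj[OF subfield_Rats dim] CF.dimension_one[OF subfield_Rats] by fastforce
  qed
  have "\<alpha> \<in> ?F" "1 \<in> ?F" by (auto intro: generate_field.incl)
  then have mem: "set [\<alpha>\<^sup>2, \<alpha>, 1] \<subseteq> ?F"
    using generate_field.eng_mult[of \<alpha> complex_field "\<rat> \<union> {\<alpha>}" \<alpha>] by (simp add: power2_eq_square)
  then have "\<not> CF.independent \<rat> [\<alpha>\<^sup>2, \<alpha>, 1]"
    using CF.independent_length_le_dimension[OF subfield_Rats dim _ mem] by auto
  then have "\<alpha>\<^sup>2 \<in> CF.Span \<rat> [\<alpha>, 1]"
    using irr independent_pair[of \<alpha>] by (auto intro: CF.li_Cons simp del: CF.Span.simps)
  then show "\<alpha> \<notin> \<rat> \<and> (\<exists>a \<in> \<rat>. \<exists>b \<in> \<rat>. \<alpha>\<^sup>2 = a * \<alpha> + b)"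
    using irr unfolding Span_pair by blast
next
  assume R: "\<alpha> \<notin> \<rat> \<and> (\<exists>a \<in> \<rat>. \<exists>b \<in> \<rat>. \<alpha>\<^sup>2 = a * \<alpha> + b)"
  have "CF.Span \<rat> [\<alpha>, 1] = ?F"
  proof
    show "CF.Span \<rat> [\<alpha>, 1] \<subseteq> ?F"
    proof
      fix x assume "x \<in> CF.Span \<rat> [\<alpha>, 1]"
      then obtain a b where x: "x = a * \<alpha> + b" and "a \<in> \<rat>" "b \<in> \<rat>" unfolding Span_pair by blast
      then have "a \<in> ?F" "b \<in> ?F" "\<alpha> \<in> ?F" by (auto intro: generate_field.incl)
      then show "x \<in> ?F" 
        using generate_field.eng_add[of "a * \<alpha>" complex_field "\<rat> \<union> {\<alpha>}" b]
          generate_field.eng_mult[of a complex_field "\<rat> \<union> {\<alpha>}" \<alpha>] by (simp add: x)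
    qed
    have sub: "subfield (CF.Span \<rat> [\<alpha>, 1]) complex_field"
      unfolding Span_pair using R quadratic_extension_subfield by blast
    have "a \<in> CF.Span \<rat> [\<alpha>, 1]" if "a \<in> \<rat>" for a
      unfolding Span_pair using that Rats_0 by (auto intro: exI[of _ "0 :: complex"])
    moreover have "\<alpha> \<in> CF.Span \<rat> [\<alpha>, 1]"
      unfolding Span_pair by (rule CollectI, rule exI[of _ 1], rule exI[of _ 0]) simp
    ultimately show "?F \<subseteq> CF.Span \<rat> [\<alpha>, 1]"
      by (intro complex_generate_field_min sub) auto
  qed
  then show "CF.dimension 2 \<rat> ?F"
    using CF.dimensionI[OF subfield_Rats, of "[\<alpha>, 1]" ?F] R independent_pair[of \<alpha>] by (simp add: numeral_2_eq_2 del: CF.Span.simps)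
qed

section \<open>Eigenvalues of cycles\<close>


text \<open>Eigenvectors are read as functions on the vertices, which removes the enumeration
  \<open>vs\<close> from the right-hand side.\<close>

lemma eigenvalue_adjacency_matrix_iff:
  assumes "distinct vs" "set vs = pverts \<Gamma>"
  shows "eigenvalue (adjacency_matrix \<Gamma> vs) \<mu> \<longleftrightarrow>
    (\<exists>f :: 'a \<Rightarrow> complex. (\<exists>u \<in> pverts \<Gamma>. f u \<noteq> 0) \<and>
       (\<forall>u \<in> pverts \<Gamma>. (\<Sum>v | v \<in> pverts \<Gamma> \<and> (u, v) \<in> parcs \<Gamma>. f v) = \<mu> * f u))"
proof -
  let ?n = "length vs" and ?A = "adjacency_matrix \<Gamma> vs"
  have fin: "finite (pverts \<Gamma>)" using assms(2) by (metis List.finite_set)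
  have bij: "bij_betw ((!) vs) {..<?n} (pverts \<Gamma>)"
    using assms by (metis bij_betw_nth)
  have mult: "(?A *\<^sub>v vec ?n (\<lambda>i. f (vs ! i))) $ i = (\<Sum>v | v \<in> pverts \<Gamma> \<and> (vs ! i, v) \<in> parcs \<Gamma>. f v)"
    if i: "i < ?n" for f :: "'a \<Rightarrow> complex" and i
  proof -
    have "(?A *\<^sub>v vec ?n (\<lambda>i. f (vs ! i))) $ i =
        (\<Sum>j<?n. if (vs ! i, vs ! j) \<in> parcs \<Gamma> then f (vs ! j) else 0)"
      using i by (auto simp: adjacency_matrix_def scalar_prod_def lessThan_atLeast0 intro!: sum.cong)
    also have "\<dots> = (\<Sum>v \<in> pverts \<Gamma>. if (vs ! i, v) \<in> parcs \<Gamma> then f v else 0)"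
      by (rule sum.reindex_bij_betw[OF bij])
    also have "\<dots> = (\<Sum>v | v \<in> pverts \<Gamma> \<and> (vs ! i, v) \<in> parcs \<Gamma>. f v)"
      by (rule sum.inter_filter[OF fin, symmetric])
    finally show ?thesis .
  qed
  have dim: "dim_row ?A = ?n" by (simp add: adjacency_matrix_def)
  have ev: "eigenvector ?A (vec ?n (\<lambda>i. f (vs ! i))) \<mu> \<longleftrightarrow>
      (\<exists>u \<in> pverts \<Gamma>. f u \<noteq> 0) \<and>
      (\<forall>u \<in> pverts \<Gamma>. (\<Sum>v | v \<in> pverts \<Gamma> \<and> (u, v) \<in> parcs \<Gamma>. f v) = \<mu> * f u)" for f :: "'a \<Rightarrow> complex"
  proof -
    have "?A *\<^sub>v vec ?n (\<lambda>i. f (vs ! i)) = \<mu> \<cdot>\<^sub>v vec ?n (\<lambda>i. f (vs ! i)) \<longleftrightarrow>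
        (\<forall>i<?n. (\<Sum>v | v \<in> pverts \<Gamma> \<and> (vs ! i, v) \<in> parcs \<Gamma>. f v) = \<mu> * f (vs ! i))"
      using mult dim by (auto simp: vec_eq_iff)
    moreover have "vec ?n (\<lambda>i. f (vs ! i)) \<noteq> 0\<^sub>v ?n \<longleftrightarrow> (\<exists>i<?n. f (vs ! i) \<noteq> 0)"
      by (auto simp: vec_eq_iff)
    ultimately show ?thesis
      unfolding eigenvector_def dim using assms(2)[symmetric] by (simp add: all_set_conv_all_nth Bex_def in_set_conv_nth) blast
  qed
  show ?thesis
  proof
    assume "eigenvalue ?A \<mu>"
    then obtain x where x: "eigenvector ?A x \<mu>" by (auto simp: eigenvalue_def)
    \<comment> \<open>A coordinate vector becomes a vertex function by looking up the position of
      the vertex in \<open>vs\<close>.\<close>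
    define f where "f v = x $ (inv_into {..<?n} ((!) vs) v)" for v
    have "dim_vec x = ?n" using x dim by (auto simp: eigenvector_def)
    moreover have "f (vs ! i) = x $ i" if "i < ?n" for i
      using that bij by (simp add: f_def bij_betw_def)
    ultimately have "vec ?n (\<lambda>i. f (vs ! i)) = x" by (auto simp: vec_eq_iff)
    with x ev[of f] show "\<exists>f :: 'a \<Rightarrow> complex. (\<exists>u \<in> pverts \<Gamma>. f u \<noteq> 0) \<and>
       (\<forall>u \<in> pverts \<Gamma>. (\<Sum>v | v \<in> pverts \<Gamma> \<and> (u, v) \<in> parcs \<Gamma>. f v) = \<mu> * f u)" by auto
  next
    assume "\<exists>f :: 'a \<Rightarrow> complex. (\<exists>u \<in> pverts \<Gamma>. f u \<noteq> 0) \<and>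
       (\<forall>u \<in> pverts \<Gamma>. (\<Sum>v | v \<in> pverts \<Gamma> \<and> (u, v) \<in> parcs \<Gamma>. f v) = \<mu> * f u)"
    with ev show "eigenvalue ?A \<mu>" unfolding eigenvalue_def by blast
  qed
qed

lemma graph_eigenvalues_iff:
  assumes "finite (pverts \<Gamma>)"
  shows "\<mu> \<in> graph_eigenvalues \<Gamma> \<longleftrightarrow>
    (\<exists>f :: 'a \<Rightarrow> complex. (\<exists>u \<in> pverts \<Gamma>. f u \<noteq> 0) \<and>
       (\<forall>u \<in> pverts \<Gamma>. (\<Sum>v | v \<in> pverts \<Gamma> \<and> (u, v) \<in> parcs \<Gamma>. f v) = \<mu> * f u))" (is "_ \<longleftrightarrow> ?P")
proof
  assume "\<mu> \<in> graph_eigenvalues \<Gamma>"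
  then obtain vs where vs: "distinct vs" "set vs = pverts \<Gamma>" "eigenvalue (adjacency_matrix \<Gamma> vs) \<mu>"
    unfolding graph_eigenvalues_def by blast
  show ?P using vs(3) unfolding eigenvalue_adjacency_matrix_iff[OF vs(1,2)] .
next
  assume P: ?P
  obtain vs where vs: "distinct vs" "set vs = pverts \<Gamma>"
    using finite_distinct_list[OF assms] by blast
  have "eigenvalue (adjacency_matrix \<Gamma> vs) \<mu>"
    using P unfolding eigenvalue_adjacency_matrix_iff[OF vs] .
  with vs show "\<mu> \<in> graph_eigenvalues \<Gamma>"
    unfolding graph_eigenvalues_def by blast
qed

text \<open>The form \<open>i + n - 1\<close> expresses the cyclic predecessor without truncated
  subtraction at i = 0.\<close>

lemma pred_mod_eq:
  fixes i n :: nat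
  assumes "i < n"
  shows "(i + n - 1) mod n = (if i = 0 then n - 1 else i - 1)"
proof (cases i)
  case (Suc k)
  then have "i + n - 1 = k + n" by simp
  then show ?thesis using assms Suc by simp
qed (use assms in simp)

lemma Suc_mod_eq: "i < n \<Longrightarrow> Suc i mod n = (if Suc i = n then 0 else Suc i)"
  by simp

lemma cycle_adjacent_iff:
  fixes i j n :: nat
  assumes "i < n" "j < n" "n \<ge> 3"
  shows "j = Suc i mod n \<or> i = Suc j mod n \<longleftrightarrow> j = Suc i mod n \<or> j = (i + n - 1) mod n"
proof -
  have "i = Suc j mod n \<longleftrightarrow> j = (i + n - 1) mod n"
    unfolding pred_mod_eq[OF assms(1)] Suc_mod_eq[OF assms(2)] using assms by auto
  then show ?thesis by simp
qed

section \<open>Periodic solutions of the cycle recurrence\<close>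

lemma periodic_mod:
  fixes g :: "nat \<Rightarrow> 'a"
  assumes "\<And>i. g (i + n) = g i"
  shows "g (i mod n) = g i"
proof -
  have "g (j + k * n) = g j" for j k
    by (induction k) (use assms[of "j + _ * n"] in \<open>auto simp: algebra_simps\<close>)
  from this[of "i mod n" "i div n"] show ?thesis by simp
qed

text \<open>With E the shift, the recurrence factors as (E - 1/z)(E - z) g = 0, so h = (E - z) g is
  geometric with ratio 1/z. If h is nonzero somewhere, its period n gives z^n = 1; otherwise g
  itself is geometric with ratio z and the period of g does. The double roots z = 1 and z = -1 are
  covered as well.\<close>

lemma cycle_recurrence_root_of_unity:
  fixes g :: "nat \<Rightarrow> complex" 
  assumes rec: "\<And>i. g (Suc (Suc i)) + g i = \<mu> * g (Suc i)"
    and per: "\<And>i. g (i + n) = g i" and nz: "g k \<noteq> 0"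
    and z: "z \<noteq> 0" "\<mu> = z + inverse z"
  shows "z ^ n = 1"
proof -
  define h where "h i = g (Suc i) - z * g i" for i
  have "z * h (Suc i) = h i" for i
  proof -
    have "h (Suc i) = \<mu> * g (Suc i) - g i - z * g (Suc i)"
      using rec[of i] by (simp add: h_def eq_diff_eq)
    also have "\<dots> = inverse z * g (Suc i) - g i" by (simp add: z(2) algebra_simps)
    finally show ?thesis using z(1) by (simp add: h_def right_diff_distrib)
  qed
  then have h_pow: "z ^ m * h (i + m) = h i" for i m
    by (induction m) (simp_all add: mult.assoc mult.left_commute[of z "z ^ _"])
  have h_per: "h (i + n) = h i" for i
    using per[of i] per[of "Suc i"] by (simp add: h_def)
  show ?thesis
  proof (cases "\<exists>i. h i \<noteq> 0")
    case True
    then obtain i where "h i \<noteq> 0" by blast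
    with h_pow[of n i] h_per[of i] show ?thesis by simp
  next
    case False
    then have "g (Suc i) = z * g i" for i by (simp add: h_def)
    then have "g (i + m) = z ^ m * g i" for i m
      by (induction m) (simp_all add: mult.assoc)
    from this[of k n] per[of k] nz show ?thesis by simp
  qed
qed

lemma cycle_graph_finite: "is_cycle_graph \<Gamma> n \<Longrightarrow> finite (pverts \<Gamma>)"
  unfolding is_cycle_graph_def using bij_betw_finite by blast

text \<open>An eigenvector, unrolled along the cycle, is an n-periodic solution of a second-order
  linear recurrence. Conversely, the powers of an n-th root of unity form an eigenvector.\<close>

lemma graph_eigenvalues_cycle:
  assumes "is_cycle_graph \<Gamma> n"
  shows "graph_eigenvalues \<Gamma> = {z + inverse z | z. z ^ n = 1}"
proof -
  obtain v where n: "n \<ge> 3" and bij: "bij_betw v {..<n} (pverts \<Gamma>)"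
    and arcs: "parcs \<Gamma> = {(v i, v j) | i j. i < n \<and> j < n \<and> (j = Suc i mod n \<or> i = Suc j mod n)}"
    using assms unfolding is_cycle_graph_def by blast
  have inj: "v i = v j \<longleftrightarrow> i = j" if "i < n" "j < n" for i j
    using bij that by (auto simp: bij_betw_def inj_on_def)
  have mem: "u \<in> pverts \<Gamma> \<longleftrightarrow> (\<exists>i<n. u = v i)" for u
    using bij by (auto simp: bij_betw_def)
  have nbrs: "(\<Sum>u | u \<in> pverts \<Gamma> \<and> (v i, u) \<in> parcs \<Gamma>. f u) = f (v (Suc i mod n)) + f (v ((i + n - 1) mod n))"
    if i: "i < n" for i and f :: "'a \<Rightarrow> complex"
  proof -
    have lt: "Suc i mod n < n" "(i + n - 1) mod n < n" using n by auto
    have "(v i, u) \<in> parcs \<Gamma> \<longleftrightarrow> (\<exists>j<n. u = v j \<and> (j = Suc i mod n \<or> j = (i + n - 1) mod n))" for u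
      unfolding arcs using i inj cycle_adjacent_iff[OF i _ n] by blast
    then have "{u. u \<in> pverts \<Gamma> \<and> (v i, u) \<in> parcs \<Gamma>} = {v (Suc i mod n), v ((i + n - 1) mod n)}"
      using mem lt by blast
    \<comment> \<open>Here n >= 3 matters: the two neighbours are distinct, so the sum has exactly
      two terms.\<close>
    moreover have "Suc i mod n \<noteq> (i + n - 1) mod n"
      unfolding pred_mod_eq[OF i] Suc_mod_eq[OF i] using i n by auto
    ultimately show ?thesis using inj[OF lt] by simp
  qed
  show ?thesis
  proof (intro Set.set_eqI iffI)
    fix \<mu> :: complex assume "\<mu> \<in> graph_eigenvalues \<Gamma>"
    then obtain f :: "'a \<Rightarrow> complex" and u where u: "u \<in> pverts \<Gamma>" "f u \<noteq> 0"
      and eig: "\<And>u. u \<in> pverts \<Gamma> \<Longrightarrow> (\<Sum>w | w \<in> pverts \<Gamma> \<and> (u, w) \<in> parcs \<Gamma>. f w) = \<mu> * f u"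
      unfolding graph_eigenvalues_iff[OF cycle_graph_finite[OF assms]] by blast
    define g where "g i = f (v (i mod n))" for i
    have "g (Suc (Suc i)) + g i = \<mu> * g (Suc i)" for i
    proof -
      have lt: "Suc i mod n < n" using n by simp
      have "g (Suc (Suc i)) = f (v (Suc (Suc i mod n) mod n))" by (simp add: g_def mod_Suc_eq)
      \<comment> \<open>The eigenvalue equation is taken at the vertex with index i + 1, whose
        predecessor is i.\<close>
      moreover have "i mod n = (Suc i mod n + n - 1) mod n"
        using mod_add_left_eq[of "Suc i" n "n - 1"] n by simp
      ultimately show ?thesis
        using eig[of "v (Suc i mod n)"] nbrs[OF lt, of f] lt mem by (auto simp: g_def)
    qed
    moreover have "g (i + n) = g i" for i by (simp add: g_def)
    moreover obtain k where "k < n" "u = v k" using u mem by blast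
    then have "g k \<noteq> 0" using u by (simp add: g_def)
    moreover obtain z where z: "z \<noteq> 0" "\<mu> = z + inverse z" by (rule obtain_joukowski)
    ultimately have "z ^ n = 1" using cycle_recurrence_root_of_unity by blast
    with z show "\<mu> \<in> {z + inverse z | z. z ^ n = 1}" by blast
  next
    fix \<mu> :: complex assume "\<mu> \<in> {z + inverse z | z. z ^ n = 1}"
    then obtain z :: complex where z: "z ^ n = 1" "\<mu> = z + inverse z" by blast
    then have z0: "z \<noteq> 0" using n by (auto simp: power_0_left)
    define f where "f u = z ^ (inv_into {..<n} v u)" for u
    have f: "f (v i) = z ^ i" if "i < n" for i
      using that bij by (simp add: f_def bij_betw_def)
    have fmod: "f (v (i mod n)) = z ^ i" for i
      using f[of "i mod n"] periodic_mod[of "\<lambda>i. z ^ i" n i] n z(1) by (simp add: power_add)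
    have "(\<Sum>w | w \<in> pverts \<Gamma> \<and> (u, w) \<in> parcs \<Gamma>. f w) = \<mu> * f u" if u: "u \<in> pverts \<Gamma>" for u
    proof -
      obtain i where i: "i < n" "u = v i" using u mem by blast
      \<comment> \<open>The value at the predecessor is z^(i - 1), written with a natural exponent
        by means of z^n = 1.\<close>
      have "z * z ^ (i + n - 1) = z ^ i"
        using n z(1) by (simp flip: power_Suc add: power_add)
      then have "z ^ (i + n - 1) = inverse z * z ^ i" using z0 by (simp add: field_simps)
      then show ?thesis
        using nbrs[OF i(1), of f] by (simp add: i f fmod z(2) distrib_right)
    qed
    moreover have "0 < n" using n by simp
    then have "v 0 \<in> pverts \<Gamma>" "f (v 0) \<noteq> 0" using mem f[of 0] by auto
    ultimately show "\<mu> \<in> graph_eigenvalues \<Gamma>"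
      unfolding graph_eigenvalues_iff[OF cycle_graph_finite[OF assms]] by blast
  qed
qed

section \<open>Cayley graphs of valency 2\<close>

text \<open>Right translation by g is injective and carries S onto the neighbours of g.\<close>

lemma Cay_out_degree:
  assumes "group G" "connection_set G S" "g \<in> carrier G"
  shows "out_degree (with_proj (Cay G S)) g = card S"
proof -
  interpret group G by fact
  have S: "S \<subseteq> carrier G" using assms(2) by (auto simp: connection_set_def)
  have "out_arcs (with_proj (Cay G S)) g = (\<lambda>s. (g, s \<otimes>\<^bsub>G\<^esub> g)) ` S"
  proof (intro equalityI subsetI)
    fix e assume "e \<in> out_arcs (with_proj (Cay G S)) g"
    then obtain h where h: "e = (g, h)" "h \<in> carrier G" "h \<otimes>\<^bsub>G\<^esub> inv\<^bsub>G\<^esub> g \<in> S"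
      by (auto simp: Cay_def out_arcs_def)
    then have "e = (g, (h \<otimes>\<^bsub>G\<^esub> inv\<^bsub>G\<^esub> g) \<otimes>\<^bsub>G\<^esub> g)" using assms(3) by (simp add: m_assoc)
    with h show "e \<in> (\<lambda>s. (g, s \<otimes>\<^bsub>G\<^esub> g)) ` S" by blast
  next
    fix e assume "e \<in> (\<lambda>s. (g, s \<otimes>\<^bsub>G\<^esub> g)) ` S"
    then show "e \<in> out_arcs (with_proj (Cay G S)) g"
      using assms(3) S by (auto simp: Cay_def out_arcs_def m_assoc subset_iff)
  qed
  moreover have "inj_on (\<lambda>s. (g, s \<otimes>\<^bsub>G\<^esub> g)) S"
    using assms(3) S by (auto simp: inj_on_def subset_iff)
  ultimately show ?thesis by (simp add: out_degree_def card_image)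
qed

lemma Cay_arc_iff:
  assumes "group G" "S \<subseteq> carrier G" "g \<in> carrier G" "h \<in> carrier G"
  shows "(g, h) \<in> parcs (Cay G S) \<longleftrightarrow> (\<exists>s \<in> S. h = s \<otimes>\<^bsub>G\<^esub> g)"
proof -
  interpret group G by fact
  have eq: "h \<otimes>\<^bsub>G\<^esub> inv\<^bsub>G\<^esub> g = s \<longleftrightarrow> h = s \<otimes>\<^bsub>G\<^esub> g" if "s \<in> S" for s
  proof
    have s: "s \<in> carrier G" using that assms(2) by blast
    show "h = s \<otimes>\<^bsub>G\<^esub> g" if "h \<otimes>\<^bsub>G\<^esub> inv\<^bsub>G\<^esub> g = s"
      unfolding that[symmetric] using assms(3,4) by (simp add: m_assoc)
    show "h \<otimes>\<^bsub>G\<^esub> inv\<^bsub>G\<^esub> g = s" if "h = s \<otimes>\<^bsub>G\<^esub> g"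
      unfolding that using assms(3) s by (simp add: m_assoc)
  qed
  have "h \<otimes>\<^bsub>G\<^esub> inv\<^bsub>G\<^esub> g \<in> S \<longleftrightarrow> (\<exists>s \<in> S. h = s \<otimes>\<^bsub>G\<^esub> g)"
    by (simp add: eq[symmetric] cong: bex_cong)
  then show ?thesis using assms(3,4) by (simp add: Cay_def)
qed

text \<open>Connectedness as an induction principle: walking from the identity, each step multiplies
  on the left by an element of S and so stays inside H.\<close>

lemma Cay_connected_closed_set:
  assumes "group G" "connection_set G S" "Digraph_Component.connected (with_proj (Cay G S))"
    and one: "\<one>\<^bsub>G\<^esub> \<in> H" and closed: "\<And>s h. s \<in> S \<Longrightarrow> h \<in> H \<Longrightarrow> s \<otimes>\<^bsub>G\<^esub> h \<in> H"
  shows "carrier G \<subseteq> H"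
proof
  interpret group G by fact
  have S: "S \<subseteq> carrier G" using assms(2) by (auto simp: connection_set_def)
  fix g assume "g \<in> carrier G"
  then have "(\<one>\<^bsub>G\<^esub>, g) \<in> rtrancl_on (carrier G) ((parcs (Cay G S))\<^sup>s)"
    using assms(3) unfolding connected_conv by (simp add: Cay_def)
  then show "g \<in> H"
  proof (induction rule: rtrancl_on_induct)
    case base
    show ?case by (fact one)
  next
    case (step y z)
    have "\<exists>s \<in> S. z = s \<otimes>\<^bsub>G\<^esub> y"
    proof (cases "(y, z) \<in> parcs (Cay G S)")
      case True
      then show ?thesis using Cay_arc_iff[OF assms(1) S] step by blast
    next
      \<comment> \<open>Connectedness refers to the symmetric closure, so the arc may be traversed
        backwards; the step then multiplies by the inverse of s, again in S.\<close>
      case False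
      then have "(z, y) \<in> parcs (Cay G S)" using step by (auto simp: symcl_def)
      then obtain s where s: "s \<in> S" "y = s \<otimes>\<^bsub>G\<^esub> z" using Cay_arc_iff[OF assms(1) S] step by blast
      then have "z = inv\<^bsub>G\<^esub> s \<otimes>\<^bsub>G\<^esub> y" using S step(4) by (simp add: m_assoc[symmetric] subset_iff)
      with s show ?thesis using assms(2) by (auto simp: connection_set_def)
    qed
    then show ?case using closed step by blast
  qed
qed

lemma cycle_graph_connected:
  assumes "is_cycle_graph \<Gamma> n"
  shows "Digraph_Component.connected (with_proj \<Gamma>)"
proof -
  obtain v where n: "n \<ge> 3" and bij: "bij_betw v {..<n} (pverts \<Gamma>)"
    and arcs: "parcs \<Gamma> = {(v i, v j) | i j. i < n \<and> j < n \<and> (j = Suc i mod n \<or> i = Suc j mod n)}"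
    using assms unfolding is_cycle_graph_def by blast
  let ?R = "rtrancl_on (pverts \<Gamma>) ((parcs \<Gamma>)\<^sup>s)"
  have mem: "u \<in> pverts \<Gamma> \<longleftrightarrow> (\<exists>i<n. u = v i)" for u
    using bij by (auto simp: bij_betw_def)
  have reach: "(v 0, v i) \<in> ?R" if "i < n" for i
    using that
  proof (induction i)
    case 0
    then show ?case using mem by blast
  next
    case (Suc i)
    have "i < n \<and> Suc i < n \<and> (Suc i = Suc i mod n \<or> i = Suc (Suc i) mod n)"
      using Suc.prems by simp
    then have "(v i, v (Suc i)) \<in> parcs \<Gamma>" unfolding arcs by blast
    then have "(v i, v (Suc i)) \<in> (parcs \<Gamma>)\<^sup>s" by (simp add: symcl_def)
    moreover have "v (Suc i) \<in> pverts \<Gamma>" using Suc mem by blast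
    ultimately show ?case using Suc by (auto intro: rtrancl_on_into_rtrancl_on)
  qed
  have "sym ((parcs \<Gamma>)\<^sup>s)" by (auto simp: symcl_def sym_def)
  then have "sym ?R" by (rule rtrancl_on_sym)
  with reach have "(u, w) \<in> ?R" if "u \<in> pverts \<Gamma>" "w \<in> pverts \<Gamma>" for u w
    using that mem by (metis rtrancl_on_trans symD)
  moreover have "pverts \<Gamma> \<noteq> {}" using mem n by (metis empty_iff less_le_trans zero_less_numeral)
  ultimately show ?thesis unfolding connected_conv by simp
qed

text \<open>The enumeration of the group by powers is kept explicit because it serves both as the
  vertex numbering of a cycle and as the isomorphism with the residues;
  \<open>s [^] n = \<one>\<close> closes the cycle.\<close>

definition cyclic_generator :: "('a, 'm) monoid_scheme \<Rightarrow> 'a \<Rightarrow> nat \<Rightarrow> bool" where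
  "cyclic_generator G s n \<longleftrightarrow> s \<in> carrier G \<and> s [^]\<^bsub>G\<^esub> n = \<one>\<^bsub>G\<^esub> \<and>
     bij_betw (\<lambda>i::nat. s [^]\<^bsub>G\<^esub> i) {..<n} (carrier G)"

lemma cyclic_generator_iso:
  assumes "group G" "cyclic_generator G s n" "n > 0"
  shows "G \<cong> integer_mod_group n"
proof -
  interpret group G by fact
  have s: "s \<in> carrier G" "s [^]\<^bsub>G\<^esub> n = \<one>\<^bsub>G\<^esub>" "bij_betw (\<lambda>i::nat. s [^]\<^bsub>G\<^esub> i) {..<n} (carrier G)"
    using assms(2) by (auto simp: cyclic_generator_def)
  \<comment> \<open>Addition in \<open>integer_mod_group n\<close> reduces modulo n, so the
    homomorphism law needs powers of s to depend only on the residue.\<close>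
  have per: "s [^]\<^bsub>G\<^esub> (k mod int n) = s [^]\<^bsub>G\<^esub> k" for k
  proof -
    have "s [^]\<^bsub>G\<^esub> k = s [^]\<^bsub>G\<^esub> (int n * (k div int n) + k mod int n)" by simp
    also have "\<dots> = (s [^]\<^bsub>G\<^esub> int n) [^]\<^bsub>G\<^esub> (k div int n) \<otimes>\<^bsub>G\<^esub> s [^]\<^bsub>G\<^esub> (k mod int n)"
      using s(1) by (simp only: int_pow_mult int_pow_pow)
    finally show ?thesis using s by (simp add: int_pow_int)
  qed
  have "bij_betw nat {0..<int n} {..<n}"
    by (rule bij_betwI[where g = int]) auto
  then have "bij_betw ((\<lambda>i::nat. s [^]\<^bsub>G\<^esub> i) \<circ> nat) {0..<int n} (carrier G)"
    using s(3) by (rule bij_betw_trans)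
  then have "bij_betw (\<lambda>k::int. s [^]\<^bsub>G\<^esub> k) {0..<int n} (carrier G)"
    by (rule bij_betw_cong[THEN iffD1, rotated]) (auto simp: int_pow_def2 nat_pow_def)
  then have "(\<lambda>k::int. s [^]\<^bsub>G\<^esub> k) \<in> iso (integer_mod_group n) G"
    using assms(3) s(1) per by (auto simp: iso_def hom_def carrier_integer_mod_group int_pow_mult)
  then show ?thesis
    using group.iso_sym[OF group_integer_mod_group] unfolding is_iso_def by blast
qed

text \<open>The generator is the image of the residue 1, which belongs to the carrier
  \<open>{0..<int n}\<close> because n > 1.\<close>

lemma iso_integer_mod_group_generator:
  assumes "group G" "G \<cong> integer_mod_group n" "n > 1"
  shows "\<exists>s. cyclic_generator G s n"
proof -
  interpret group G by fact
  obtain h where "h \<in> iso (integer_mod_group n) G"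
    using iso_sym[OF assms(2)] unfolding is_iso_def by blast
  then have h: "h \<in> hom (integer_mod_group n) G" "bij_betw h {0..<int n} (carrier G)"
    using assms(3) by (auto simp: iso_def carrier_integer_mod_group)
  interpret h: group_hom "integer_mod_group n" G h
    using h(1) by (simp add: group_hom_def group_hom_axioms_def is_group)
  have one: "1 \<in> carrier (integer_mod_group n)" using assms(3) by simp
  have pow: "h 1 [^]\<^bsub>G\<^esub> i = h (int i mod int n)" for i :: nat
    using h.hom_nat_pow[OF one, of i] by simp
  have "bij_betw int {..<n} {0..<int n}"
    by (rule bij_betwI[where g = nat]) auto
  then have "bij_betw (h \<circ> int) {..<n} (carrier G)" using h(2) by (rule bij_betw_trans)
  then have "bij_betw (\<lambda>i::nat. h 1 [^]\<^bsub>G\<^esub> i) {..<n} (carrier G)"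
    by (rule bij_betw_cong[THEN iffD1, rotated]) (auto simp: pow)
  moreover have "h 1 [^]\<^bsub>G\<^esub> n = \<one>\<^bsub>G\<^esub>" using pow[of n] h.hom_one by simp
  ultimately show ?thesis using one h.hom_closed unfolding cyclic_generator_def by blast
qed

text \<open>Numbering the elements as powers of s, multiplication by s is one step forward around
  the cycle and multiplication by its inverse one step back.\<close>

lemma cyclic_generator_Cay_cycle:
  assumes "group G" "cyclic_generator G s n" "n \<ge> 3"
  shows "is_cycle_graph (Cay G {s, inv\<^bsub>G\<^esub> s}) n"
proof -
  interpret group G by fact
  have s: "s \<in> carrier G" "s [^]\<^bsub>G\<^esub> n = \<one>\<^bsub>G\<^esub>" "bij_betw (\<lambda>i::nat. s [^]\<^bsub>G\<^esub> i) {..<n} (carrier G)"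
    using assms(2) by (auto simp: cyclic_generator_def)
  have step: "s [^]\<^bsub>G\<^esub> j = s \<otimes>\<^bsub>G\<^esub> s [^]\<^bsub>G\<^esub> i \<longleftrightarrow> j = Suc i mod n" if "i < n" "j < n" for i j :: nat
  proof -
    \<comment> \<open>The wrap-around case i + 1 = n is where \<open>s [^] n = \<one>\<close>
      enters.\<close>
    have "s \<otimes>\<^bsub>G\<^esub> s [^]\<^bsub>G\<^esub> i = s [^]\<^bsub>G\<^esub> (Suc i mod n)"
      using that s by (cases "Suc i = n") (auto simp: nat_pow_Suc2[symmetric])
    moreover have "Suc i mod n < n" using that by simp
    ultimately show ?thesis using that s(3) by (auto simp: bij_betw_def inj_on_def)
  qed
  have arc: "(g, h) \<in> parcs (Cay G {s, inv\<^bsub>G\<^esub> s}) \<longleftrightarrow> h = s \<otimes>\<^bsub>G\<^esub> g \<or> g = s \<otimes>\<^bsub>G\<^esub> h"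
    if "g \<in> carrier G" "h \<in> carrier G" for g h
  proof -
    have "h = inv\<^bsub>G\<^esub> s \<otimes>\<^bsub>G\<^esub> g \<longleftrightarrow> g = s \<otimes>\<^bsub>G\<^esub> h"
    proof
      show "g = s \<otimes>\<^bsub>G\<^esub> h" if "h = inv\<^bsub>G\<^esub> s \<otimes>\<^bsub>G\<^esub> g"
        unfolding that using s(1) \<open>g \<in> carrier G\<close> by (simp add: m_assoc[symmetric])
      show "h = inv\<^bsub>G\<^esub> s \<otimes>\<^bsub>G\<^esub> g" if "g = s \<otimes>\<^bsub>G\<^esub> h"
        unfolding that using s(1) \<open>h \<in> carrier G\<close> by (simp add: m_assoc[symmetric])
    qed
    then show ?thesis using Cay_arc_iff[OF assms(1) _ that, of "{s, inv\<^bsub>G\<^esub> s}"] s(1) by simp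
  qed
  have "parcs (Cay G {s, inv\<^bsub>G\<^esub> s}) =
      {(s [^]\<^bsub>G\<^esub> i, s [^]\<^bsub>G\<^esub> j) | i j. i < n \<and> j < n \<and> (j = Suc i mod n \<or> i = Suc j mod n)}"
  proof (intro equalityI subrelI)
    fix g h assume gh: "(g, h) \<in> parcs (Cay G {s, inv\<^bsub>G\<^esub> s})"
    then have "g \<in> carrier G" "h \<in> carrier G" by (auto simp: Cay_def)
    moreover from this obtain i j where "i < n" "g = s [^]\<^bsub>G\<^esub> i" "j < n" "h = s [^]\<^bsub>G\<^esub> j"
      using s(3) unfolding bij_betw_def by blast
    ultimately show "(g, h) \<in> {(s [^]\<^bsub>G\<^esub> i, s [^]\<^bsub>G\<^esub> j) | i j. i < n \<and> j < n \<and> (j = Suc i mod n \<or> i = Suc j mod n)}"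
      using gh arc step by blast
  next
    fix g h assume "(g, h) \<in> {(s [^]\<^bsub>G\<^esub> i, s [^]\<^bsub>G\<^esub> j) | i j. i < n \<and> j < n \<and> (j = Suc i mod n \<or> i = Suc j mod n)}"
    then show "(g, h) \<in> parcs (Cay G {s, inv\<^bsub>G\<^esub> s})"
      using arc step s(1) by (smt (verit) Pair_inject mem_Collect_eq nat_pow_closed)
  qed
  then show ?thesis
    unfolding is_cycle_graph_def using assms(3) s(3) by (intro conjI exI[of _ "\<lambda>i. s [^]\<^bsub>G\<^esub> i"]) (simp_all add: Cay_def)
qed

lemma cyclic_generatorI:
  assumes "group G" "finite (carrier G)" "s \<in> carrier G" "carrier G \<subseteq> range (\<lambda>i::nat. s [^]\<^bsub>G\<^esub> i)"
  shows "cyclic_generator G s (group.ord G s)"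
proof -
  interpret group G by fact
  have pos: "ord s > 0" using ord_ge_1[OF assms(2,3)] by simp
  have "carrier G = (\<lambda>i::nat. s [^]\<^bsub>G\<^esub> i) ` {..<ord s}"
  proof (intro equalityI subsetI)
    fix g assume "g \<in> carrier G"
    then obtain i :: nat where "g = s [^]\<^bsub>G\<^esub> i" using assms(4) by blast
    also have "\<dots> = s [^]\<^bsub>G\<^esub> (ord s * (i div ord s) + i mod ord s)" by simp
    also have "\<dots> = s [^]\<^bsub>G\<^esub> (i mod ord s)"
      using assms(3) by (simp only: nat_pow_mult[symmetric] nat_pow_pow[symmetric] pow_ord_eq_1) simp
    finally have "g = s [^]\<^bsub>G\<^esub> (i mod ord s)" .
    then show "g \<in> (\<lambda>i::nat. s [^]\<^bsub>G\<^esub> i) ` {..<ord s}" using pos by simp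
  qed (use assms(3) in auto)
  moreover have "inj_on (\<lambda>i::nat. s [^]\<^bsub>G\<^esub> i) {..<ord s}"
    by (rule inj_on_subset[OF ord_inj[OF assms(3)]]) auto
  ultimately show ?thesis
    using assms(3) by (auto simp: cyclic_generator_def bij_betw_def)
qed

text \<open>Multiplying alternately by a and b walks through 1, a, ab, b and back to 1.\<close>

lemma Klein_four_Cay_cycle:
  assumes "comm_group G" "{a, b} \<subseteq> carrier G - {\<one>\<^bsub>G\<^esub>}" "a \<noteq> b"
    and sq: "a \<otimes>\<^bsub>G\<^esub> a = \<one>\<^bsub>G\<^esub>" "b \<otimes>\<^bsub>G\<^esub> b = \<one>\<^bsub>G\<^esub>"
    and sub: "carrier G \<subseteq> {\<one>\<^bsub>G\<^esub>, a, a \<otimes>\<^bsub>G\<^esub> b, b}"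
  shows "is_cycle_graph (Cay G {a, b}) 4"
proof -
  interpret comm_group G by fact
  define c where "c = a \<otimes>\<^bsub>G\<^esub> b"
  have ab: "a \<in> carrier G" "b \<in> carrier G" "c \<in> carrier G" using assms(2) by (auto simp: c_def)
  have prod: "a \<otimes>\<^bsub>G\<^esub> b = c" "b \<otimes>\<^bsub>G\<^esub> a = c"
    using ab m_comm by (simp_all add: c_def)
  have "a \<otimes>\<^bsub>G\<^esub> c = b"
    unfolding prod(1)[symmetric] using ab sq(1) by (simp add: m_assoc[symmetric])
  moreover have "b \<otimes>\<^bsub>G\<^esub> c = a"
    unfolding prod(2)[symmetric] using ab sq(2) by (simp add: m_assoc[symmetric])
  ultimately have mult: "a \<otimes>\<^bsub>G\<^esub> b = c" "b \<otimes>\<^bsub>G\<^esub> a = c" "a \<otimes>\<^bsub>G\<^esub> c = b" "b \<otimes>\<^bsub>G\<^esub> c = a"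
    using prod by blast+
  \<comment> \<open>Each coincidence with c = ab is refuted by the multiplication table: c = 1 would
    give a = b, c = a would give b = 1, and c = b would give a = 1.\<close>
  have dist: "distinct [\<one>\<^bsub>G\<^esub>, a, c, b]"
  proof -
    have "c \<noteq> \<one>\<^bsub>G\<^esub>" using mult(3) ab(1) assms(3) by auto
    moreover have "c \<noteq> a" using mult(3) sq(1) assms(2) by auto
    moreover have "c \<noteq> b" using mult(4) sq(2) assms(2) by auto
    ultimately show ?thesis using assms(2,3) by auto
  qed
  have carrier: "carrier G = {\<one>\<^bsub>G\<^esub>, a, c, b}" using sub ab unfolding c_def by auto
  define v where "v = (!) [\<one>\<^bsub>G\<^esub>, a, c, b]"
  have v: "v 0 = \<one>\<^bsub>G\<^esub>" "v (Suc 0) = a" "v 2 = c" "v 3 = b" by (simp_all add: v_def)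
  have "bij_betw v {..<4} (carrier G)"
    unfolding carrier v_def using bij_betw_nth[OF dist, of "{..<4}"] by simp
  moreover have "parcs (Cay G {a, b}) =
      {(v i, v j) | i j. i < 4 \<and> j < 4 \<and> (j = Suc i mod 4 \<or> i = Suc j mod 4)}"
  proof -
    have "parcs (Cay G {a, b}) = {(g, h). g \<in> carrier G \<and> (h = a \<otimes>\<^bsub>G\<^esub> g \<or> h = b \<otimes>\<^bsub>G\<^esub> g)}"
    proof (intro equalityI subrelI)
      fix g h assume *: "(g, h) \<in> parcs (Cay G {a, b})"
      then have "g \<in> carrier G" "h \<in> carrier G" by (auto simp: Cay_def)
      with * Cay_arc_iff[OF is_group, of "{a, b}" g h] ab
      show "(g, h) \<in> {(g, h). g \<in> carrier G \<and> (h = a \<otimes>\<^bsub>G\<^esub> g \<or> h = b \<otimes>\<^bsub>G\<^esub> g)}" by simp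
    next
      fix g h assume *: "(g, h) \<in> {(g, h). g \<in> carrier G \<and> (h = a \<otimes>\<^bsub>G\<^esub> g \<or> h = b \<otimes>\<^bsub>G\<^esub> g)}"
      then have "g \<in> carrier G" "h \<in> carrier G" using ab by auto
      with * Cay_arc_iff[OF is_group, of "{a, b}" g h] ab
      show "(g, h) \<in> parcs (Cay G {a, b})" by simp
    qed
    also have "\<dots> = (\<lambda>g. (g, a \<otimes>\<^bsub>G\<^esub> g)) ` carrier G \<union> (\<lambda>g. (g, b \<otimes>\<^bsub>G\<^esub> g)) ` carrier G"
      by blast
    \<comment> \<open>Each of a and b contributes four arcs; together they are the four edges of the
      square in both directions.\<close>
    also have "\<dots> = (\<lambda>(i, j). (v i, v j)) ` {(0, 1), (1, 0), (1, 2), (2, 1), (2, 3), (3, 2), (3, 0), (0, 3)}"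
      unfolding carrier using ab(1,2) by (simp add: v mult sq) blast
    also have "{(0, 1), (1, 0), (1, 2), (2, 1), (2, 3), (3, 2), (3, 0), (0, 3)} =
        {(i, j). i < 4 \<and> j < (4 :: nat) \<and> (j = Suc i mod 4 \<or> i = Suc j mod 4)}"
    proof (intro equalityI subrelI)
      fix i j :: nat
      assume "(i, j) \<in> {(i, j). i < 4 \<and> j < 4 \<and> (j = Suc i mod 4 \<or> i = Suc j mod 4)}"
      then have "i < 4" "j < 4" and adj: "j = Suc i mod 4 \<or> i = Suc j mod 4" by simp_all
      then have "i = 0 \<or> i = 1 \<or> i = 2 \<or> i = 3" "j = 0 \<or> j = 1 \<or> j = 2 \<or> j = 3" by linarith+
      then show "(i, j) \<in> {(0, 1), (1, 0), (1, 2), (2, 1), (2, 3), (3, 2), (3, 0), (0, 3)}"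
        by (elim disjE) (use adj in simp_all)
    qed (elim insertE emptyE, simp_all)
    finally show ?thesis by auto
  qed
  ultimately show ?thesis unfolding is_cycle_graph_def by (auto simp: Cay_def)
qed

section \<open>2-integral cycles and Cayley graphs\<close>

text \<open>Write z as a power of the primitive root w. The sums w^m + w^-m obey the recurrence of
  \<open>cheb\<close>, so \<open>cheb.induct\<close> keeps them in the field generated by w +
  1/w.\<close>

lemma root_of_unity_sum_in_generated_field:
  assumes "n > 0" "z ^ n = 1"
  shows "z + inverse z \<in> generate_field complex_field (\<rat> \<union> {complex_of_real (two_cos n)})"
    (is "_ \<in> ?F")
proof -
  define w where "w = cis (2 * pi / n)"
  obtain k :: nat where k: "z = w ^ k"
  proof -
    have "z \<in> {z. z ^ n = 1}" using assms by simp
    also have "\<dots> = (\<lambda>k. cis (2 * pi * real k / real n)) ` {..<n}"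
      using bij_betw_roots_unity[OF assms(1)] by (simp add: bij_betw_def)
    finally obtain k where "z = cis (2 * pi * real k / real n)" by blast
    then have "z = w ^ k" by (simp add: w_def DeMoivre mult.commute)
    then show ?thesis by (rule that)
  qed
  have w: "w \<noteq> 0" by (simp add: w_def)
  have \<alpha>: "w + inverse w \<in> ?F"
    unfolding w_def of_real_two_cos[symmetric] by (auto intro: generate_field.incl)
  have add: "x + y \<in> ?F" and mult: "x * y \<in> ?F" and minus: "- x \<in> ?F"
    if "x \<in> ?F" "y \<in> ?F" for x y
    using that generate_field.eng_add[of x complex_field _ y] generate_field.eng_mult[of x complex_field _ y]
      generate_field.a_inv[of x complex_field] by simp_all
  have "w ^ m + inverse w ^ m \<in> ?F" for m
  proof (induction m rule: cheb.induct)
    case 1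
    have "(2 :: complex) \<in> ?F" by (intro generate_field.incl) simp
    then show ?case by simp
  next
    case 2
    then show ?case using \<alpha> by simp
  next
    case (3 m)
    have "inverse w * w ^ Suc m = w ^ m" "w * inverse w ^ Suc m = inverse w ^ m"
      using w by simp_all
    then have "w ^ Suc (Suc m) + inverse w ^ Suc (Suc m) =
        (w + inverse w) * (w ^ Suc m + inverse w ^ Suc m) + - (w ^ m + inverse w ^ m)"
      by (simp only: distrib_left distrib_right power_Suc) simp
    then show ?case using add mult minus 3 \<alpha> by metis
  qed
  from this[of k] show ?thesis by (simp add: k power_inverse)
qed

lemma two_integral_cycle_iff:
  assumes "is_cycle_graph \<Gamma> n"
  shows "two_integral \<Gamma> \<longleftrightarrow> n \<in> {5, 8, 10, 12}"
proof -
  let ?\<alpha> = "complex_of_real (two_cos n)"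
  have n: "n \<ge> 3" using assms by (simp add: is_cycle_graph_def)
  have "cis (2 * pi / n) ^ n = 1" using n by (simp add: DeMoivre)
  then have "?\<alpha> \<in> graph_eigenvalues \<Gamma>"
    unfolding graph_eigenvalues_cycle[OF assms] of_real_two_cos by blast
  moreover have "graph_eigenvalues \<Gamma> \<subseteq> generate_field complex_field (\<rat> \<union> {?\<alpha>})"
    unfolding graph_eigenvalues_cycle[OF assms] using root_of_unity_sum_in_generated_field n by auto
  ultimately have "splitting_field \<Gamma> = generate_field complex_field (\<rat> \<union> {?\<alpha>})"
    unfolding splitting_field_def by (intro generate_field_absorb)
  then have "two_integral \<Gamma> \<longleftrightarrow> ?\<alpha> \<notin> \<rat> \<and> (\<exists>a \<in> \<rat>. \<exists>b \<in> \<rat>. ?\<alpha>\<^sup>2 = a * ?\<alpha> + b)"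
    unfolding two_integral_def by (simp only: dimension_2_simple_extension)
  also have "\<dots> \<longleftrightarrow> n \<in> {5, 8, 10, 12}"
    using two_cos_quadratic_imp[OF n] two_cos_quadratic by blast
  finally show ?thesis .
qed

lemma cyclic_imp_two_integral_Cay:
  assumes "group G" "cyclic_generator G s n" "n \<in> {5, 8, 10, 12}"
  shows "G \<in> \<G> 2"
proof -
  interpret group G by fact
  have n: "n \<ge> 5" using assms(3) by auto
  have s: "s \<in> carrier G" and bij: "bij_betw (\<lambda>i::nat. s [^]\<^bsub>G\<^esub> i) {..<n} (carrier G)"
    using assms(2) by (auto simp: cyclic_generator_def)
  let ?S = "{s, inv\<^bsub>G\<^esub> s}"
  \<comment> \<open>Applied to the exponents 1 and 2, this shows that s is neither the identity nor
    an involution, so \<open>?S\<close> has exactly two elements.\<close>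
  have ne: "s [^]\<^bsub>G\<^esub> i \<noteq> \<one>\<^bsub>G\<^esub>" if "0 < i" "i < n" for i :: nat
    using inj_onD[OF bij_betw_imp_inj_on[OF bij], of i 0] that by auto
  have "s \<noteq> \<one>\<^bsub>G\<^esub>" using ne[of 1] n s by simp
  moreover have "s \<otimes>\<^bsub>G\<^esub> s \<noteq> \<one>\<^bsub>G\<^esub>" using ne[of 2] n s by (simp add: numeral_2_eq_2)
  then have "s \<noteq> inv\<^bsub>G\<^esub> s" using s by (metis r_inv)
  ultimately have S: "connection_set G ?S" "card ?S = 2"
    using s by (auto simp: connection_set_def)
  have cycle: "is_cycle_graph (Cay G ?S) n"
    using cyclic_generator_Cay_cycle[OF assms(1,2)] n by simp
  have "finite (carrier G)" using bij bij_betw_finite by blast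
  moreover have "has_valency (Cay G ?S) 2"
    using Cay_out_degree[OF assms(1) S(1)] S(2) by (simp add: has_valency_def Cay_def)
  moreover have "two_integral (Cay G ?S)" using two_integral_cycle_iff[OF cycle] assms(3) by simp
  ultimately show ?thesis
    unfolding groups_with_2_integral_Cay_def
    using assms(1) S(1) cycle_graph_connected[OF cycle] by blast
qed

lemma two_integral_Cay_imp_cyclic:
  assumes "comm_group G" "G \<in> \<G> 2"
  shows "\<exists>n \<in> {5, 8, 10, 12}. G \<cong> integer_mod_group n"
proof -
  interpret comm_group G by fact
  obtain S where fin: "finite (carrier G)" and S: "connection_set G S"
    and conn: "Digraph_Component.connected (with_proj (Cay G S))"
    and val: "has_valency (Cay G S) 2" and two_int: "two_integral (Cay G S)"
    using assms(2) unfolding groups_with_2_integral_Cay_def by blast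
  have "card S = 2"
    using val Cay_out_degree[OF is_group S one_closed] by (simp add: has_valency_def Cay_def)
  then obtain a b where ab: "S = {a, b}" "a \<noteq> b" by (auto simp: card_2_iff)
  have mem: "a \<in> carrier G" "b \<in> carrier G" "a \<noteq> \<one>\<^bsub>G\<^esub>" "b \<noteq> \<one>\<^bsub>G\<^esub>" "inv\<^bsub>G\<^esub> a \<in> {a, b}" "inv\<^bsub>G\<^esub> b \<in> {a, b}"
    using S ab by (auto simp: connection_set_def)
  note closed = Cay_connected_closed_set[OF is_group S conn, unfolded ab]
  show ?thesis
  proof (cases "inv\<^bsub>G\<^esub> a = a")
    case True
    \<comment> \<open>Inversion permutes {a, b}; since it fixes a, it fixes b.\<close>
    then have "inv\<^bsub>G\<^esub> b = b" using mem ab(2) by (metis inv_inv insertE empty_iff)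
    with True have sq: "a \<otimes>\<^bsub>G\<^esub> a = \<one>\<^bsub>G\<^esub>" "b \<otimes>\<^bsub>G\<^esub> b = \<one>\<^bsub>G\<^esub>" using mem by (metis r_inv)+
    have "a \<otimes>\<^bsub>G\<^esub> (a \<otimes>\<^bsub>G\<^esub> b) = b" using sq mem by (simp flip: m_assoc)
    moreover have "b \<otimes>\<^bsub>G\<^esub> (a \<otimes>\<^bsub>G\<^esub> b) = a" using sq mem by (metis m_comm m_assoc r_one)
    ultimately have "carrier G \<subseteq> {\<one>\<^bsub>G\<^esub>, a, a \<otimes>\<^bsub>G\<^esub> b, b}"
      using mem sq m_comm[of a b] by (intro closed) auto
    then have "is_cycle_graph (Cay G S) 4"
      unfolding ab(1) using Klein_four_Cay_cycle[OF assms(1) _ ab(2) sq] mem by simp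
    \<comment> \<open>The case is contradictory: 4 is not among the admissible cycle
      lengths.\<close>
    then show ?thesis using two_int two_integral_cycle_iff by fastforce
  next
    case False
    then have b: "b = inv\<^bsub>G\<^esub> a" using mem by simp
    let ?n = "ord a"
    have "carrier G \<subseteq> range (\<lambda>i::nat. a [^]\<^bsub>G\<^esub> i)"
    proof (rule closed)
      show "\<one>\<^bsub>G\<^esub> \<in> range (\<lambda>i::nat. a [^]\<^bsub>G\<^esub> i)" by (rule range_eqI[of _ _ 0]) simp
      \<comment> \<open>Finite order makes the inverse a natural power of a, so the natural powers
        are closed under multiplication by both elements of S.\<close>
      have inv_a: "inv\<^bsub>G\<^esub> a = a [^]\<^bsub>G\<^esub> (?n - 1)"
      proof (rule inv_equality)
        have "?n = Suc (?n - 1)" using ord_ge_1[OF fin mem(1)] by simp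
        then show "a [^]\<^bsub>G\<^esub> (?n - 1) \<otimes>\<^bsub>G\<^esub> a = \<one>\<^bsub>G\<^esub>"
          using pow_ord_eq_1[OF mem(1)] by (metis nat_pow_Suc)
      qed (use mem in auto)
      fix s h assume "s \<in> {a, b}" "h \<in> range (\<lambda>i::nat. a [^]\<^bsub>G\<^esub> i)"
      then obtain i j :: nat where "s = a [^]\<^bsub>G\<^esub> i" "h = a [^]\<^bsub>G\<^esub> j"
        using b inv_a nat_pow_eone[OF mem(1)] by (metis insertE empty_iff imageE)
      then show "s \<otimes>\<^bsub>G\<^esub> h \<in> range (\<lambda>i::nat. a [^]\<^bsub>G\<^esub> i)"
        using nat_pow_mult[OF mem(1)] by auto
    qed
    then have gen: "cyclic_generator G a ?n" by (rule cyclic_generatorI[OF is_group fin mem(1)])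
    have "?n \<noteq> 0" using ord_ge_1[OF fin mem(1)] by simp
    moreover have "?n \<noteq> 1" using ord_eq_1[OF mem(1)] mem by blast
    \<comment> \<open>Order 2 would make a its own inverse, against the case assumption; this
      secures the length of at least 3 that a cycle must have.\<close>
    moreover have "?n \<noteq> 2"
    proof
      assume "?n = 2"
      then have "a \<otimes>\<^bsub>G\<^esub> a = \<one>\<^bsub>G\<^esub>" using pow_ord_eq_1[OF mem(1)] mem by (simp add: numeral_2_eq_2)
      then show False using False inv_equality mem by blast
    qed
    ultimately have "?n \<ge> 3" by linarith
    then have "is_cycle_graph (Cay G S) ?n"
      unfolding ab(1) b by (rule cyclic_generator_Cay_cycle[OF is_group gen])
    then have "?n \<in> {5, 8, 10, 12}" using two_int two_integral_cycle_iff by blast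
    moreover have "G \<cong> integer_mod_group ?n"
      using cyclic_generator_iso[OF is_group gen] \<open>?n \<noteq> 0\<close> by simp
    ultimately show ?thesis by blast
  qed
qed

theorem theorem5p1:
  fixes G :: "('a, 'm) monoid_scheme"
  assumes "comm_group G" and "finite (carrier G)"
  shows "(G \<in> \<G> 2 \<longleftrightarrow> (\<exists>n \<in> {5, 8, 10, 12}. G \<cong> integer_mod_group n)) \<and>
         (\<forall>n (\<Gamma> :: 'b pair_pre_digraph).
            is_cycle_graph \<Gamma> n \<longrightarrow> (two_integral \<Gamma> \<longleftrightarrow> n \<in> {5, 8, 10, 12}))"
proof (intro conjI allI impI iffI)
  have G: "group G" using assms(1) by (simp add: comm_group_def)
  show "\<exists>n \<in> {5, 8, 10, 12}. G \<cong> integer_mod_group n" if "G \<in> \<G> 2"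
    using two_integral_Cay_imp_cyclic[OF assms(1) that] .
  show "G \<in> \<G> 2" if "\<exists>n \<in> {5, 8, 10, 12}. G \<cong> integer_mod_group n"
  proof -
    from that obtain n where n: "n \<in> {5, 8, 10, 12}" "G \<cong> integer_mod_group n" by blast
    moreover have "n > 1" using n(1) by auto
    ultimately show ?thesis
      using iso_integer_mod_group_generator[OF G] cyclic_imp_two_integral_Cay[OF G] by blast
  qed
qed (use two_integral_cycle_iff in blast)+

end
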